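(* Let Assumptions A and B hold, fix $\delta>0$, and run the algorithm with initialization $\sum_{i=1}^Ny_i^0=b-(\sigma^{\mathrm{ASY}}+\delta)\mathbf 1$ (i.e. restriction $r=(\sigma^{\mathrm{ASY}}+\delta)\mathbf 1$). Then there exists a finite time $T_\delta>0$ such that for all $t\ge T_\delta$ the mixed-integer vector $(x_1^t,\dots,x_N^t)$ produced by (P3) is feasible for the MILP, i.e. $x_i^t\in X_i$ for all $i$ and $\sum_{i=1}^NA_ix_i^t\preceq b$.
   Context: Data: for each $i\in\{1,\dots,N\}$, $c_i\in\mathbb{R}^{n_i}$, $A_i\in\mathbb{R}^{S\times n_i}$ (rows $A_i^s$), nonempty compact $X_i=\{x_i\in\mathbb{Z}^{Z_i}\times\mathbb{R}^{R_i}:D_ix_i\preceq d_i\}$; $b\in\mathbb{R}^S$. $\preceq$ is componentwise, $\mathbf 1$ the all-ones vector. MILP: minimize $\sum_ic_i^\top x_i$ s.t. $\sum_iA_ix_i\preceq b$, $x_i\in X_i$ (assumed feasible). Restricted LP (LP$_r$): minimize $\sum_ic_i^\top z_i$ s.t. $\sum_iA_iz_i\preceq b-r$, $z_i\in\mathrm{conv}(X_i)$. Restriction: $L_i^s=\min_{x_i\in X_i}A_i^sx_i$; $(x_i^L,\tilde\ell_i)$ optimal for minimize $\ell_i$ over $x_i\in X_i,\ell_i\in\mathbb{R}$ s.t. $A_ix_i-L_i\preceq\ell_i\mathbf 1$; $\sigma^{\mathrm{ASY}}=(S+1)\max_i\max_s(A_i^sx_i^L-L_i^s)$. Assumption A: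 (LP$_r$) with $r=(\sigma^{\mathrm{ASY}}+\delta)\mathbf 1$ is feasible with unique optimal solution. Assumption B: step-sizes $\alpha^t\ge0$, $\sum_t\alpha^t=\infty$, $\sum_t(\alpha^t)^2<\infty$. Algorithm over a connected undirected graph with neighbor sets $\mathcal N_i$, parameter $M>0$ sufficiently large. At each $t$, agent $i$: (P1) computes a primal-dual optimal pair $((z_i^t,v_i^t),\mu_i^t)$ of: minimize $c_i^\top z_i+Mv_i$ over $z_i\in\mathrm{conv}(X_i)$, $v_i\ge0$, s.t. $A_iz_i\preceq y_i^t+v_i\mathbf 1$ ($\mu_i^t$ the multiplier of this constraint); (P2) $y_i^{t+1}=y_i^t+\alpha^t\sum_{j\in\mathcal N_i}(\mu_i^t-\mu_j^t)$; (P3) computes $x_i^t$ via: minimize lexicographically $(\rho_i,\xi_i)$ over $x_i\in X_i,\rho_i\ge0,\xi_i$ s.t. $c_i^\top x_i\le\xi_i$, $A_ix_i\preceq y_i^t+\rho_i\mathbf 1$ (first minimize $\rho_i$, then $c_i^\top x_i$ with $\rho_i$ fixed at its minimum). *)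

theory Defs
  imports "HOL-Analysis.Analysis"
begin

(* Vectors of R^n are represented as functions nat => real that vanish at
   indices >= n.  Matrices are functions nat => nat => real (row, column). *)

definition dotp :: "nat \<Rightarrow> (nat \<Rightarrow> real) \<Rightarrow> (nat \<Rightarrow> real) \<Rightarrow> real" where
  "dotp n a x = (\<Sum>k<n. a k * x k)"

(* X_i = { x in Z^Z x R^R : D x <= d }, with n = Z + R and D having m rows;
   the first Z coordinates are the integer ones. *)
definition MIset :: "nat \<Rightarrow> nat \<Rightarrow> nat \<Rightarrow> (nat \<Rightarrow> nat \<Rightarrow> real) \<Rightarrow> (nat \<Rightarrow> real)
                      \<Rightarrow> (nat \<Rightarrow> real) set" where
  "MIset Z R m D d = {x. (\<forall>k\<ge>Z + R. x k = 0) \<and> (\<forall>k<Z. x k \<in> \<int>) \<and>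
                         (\<forall>r<m. dotp (Z + R) (D r) x \<le> d r)}"

(* convex hull (explicit form: all finite convex combinations) *)
definition conv :: "(nat \<Rightarrow> real) set \<Rightarrow> (nat \<Rightarrow> real) set" where
  "conv S = {x. \<exists>F u. finite F \<and> F \<subseteq> S \<and> (\<forall>y\<in>F. 0 \<le> u y) \<and> sum u F = 1 \<and>
                     x = (\<lambda>k. \<Sum>y\<in>F. u y * y k)}"

(* connected undirected graph on agents {0..<N} given by neighbour sets Nb *)
definition connected_undirected :: "nat \<Rightarrow> (nat \<Rightarrow> nat set) \<Rightarrow> bool" where
  "connected_undirected N Nb \<longleftrightarrow>
     (\<forall>i<N. Nb i \<subseteq> {0..<N} \<and> i \<notin> Nb i) \<and>
     (\<forall>i<N. \<forall>j<N. j \<in> Nb i \<longleftrightarrow> i \<in> Nb j) \<and>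
     (\<forall>i<N. \<forall>j<N. (i, j) \<in> {(a, b). a < N \<and> b \<in> Nb a}\<^sup>*)"

(* L_i^s = min_{x in X_i} A_i^s x *)
definition Lmin :: "(nat \<Rightarrow> real) set \<Rightarrow> nat \<Rightarrow> (nat \<Rightarrow> real) \<Rightarrow> real" where
  "Lmin X n a = (INF x\<in>X. dotp n a x)"

(* (xL, l) is optimal for: minimize l over x in X, l real, s.t. A x - L <= l 1 *)
definition Lopt :: "(nat \<Rightarrow> real) set \<Rightarrow> nat \<Rightarrow> nat \<Rightarrow> (nat \<Rightarrow> nat \<Rightarrow> real)
                    \<Rightarrow> (nat \<Rightarrow> real) \<Rightarrow> real \<Rightarrow> bool" where
  "Lopt X n S A xL l \<longleftrightarrow>
     xL \<in> X \<and> (\<forall>s<S. dotp n (A s) xL - Lmin X n (A s) \<le> l) \<and>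
     (\<forall>x\<in>X. \<forall>l'. (\<forall>s<S. dotp n (A s) x - Lmin X n (A s) \<le> l') \<longrightarrow> l \<le> l')"

(* sigma^ASY = (S+1) max_i max_s (A_i^s x_i^L - L_i^s) *)
definition sigmaASY :: "nat \<Rightarrow> nat \<Rightarrow> (nat \<Rightarrow> (nat \<Rightarrow> real) set) \<Rightarrow> (nat \<Rightarrow> nat)
       \<Rightarrow> (nat \<Rightarrow> nat \<Rightarrow> nat \<Rightarrow> real) \<Rightarrow> (nat \<Rightarrow> nat \<Rightarrow> real) \<Rightarrow> real" where
  "sigmaASY N S X n A xL =
     real (S + 1) * (MAX i\<in>{0..<N}. MAX s\<in>{0..<S}. dotp (n i) (A i s) (xL i) - Lmin (X i) (n i) (A i s))"

(* feasibility for the MILP *)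
definition MILP_feasible :: "nat \<Rightarrow> nat \<Rightarrow> (nat \<Rightarrow> (nat \<Rightarrow> real) set) \<Rightarrow> (nat \<Rightarrow> nat)
       \<Rightarrow> (nat \<Rightarrow> nat \<Rightarrow> nat \<Rightarrow> real) \<Rightarrow> (nat \<Rightarrow> real) \<Rightarrow> (nat \<Rightarrow> nat \<Rightarrow> real) \<Rightarrow> bool" where
  "MILP_feasible N S X n A b x \<longleftrightarrow>
     (\<forall>i<N. x i \<in> X i) \<and> (\<forall>s<S. (\<Sum>i<N. dotp (n i) (A i s) (x i)) \<le> b s)"

(* feasibility / optimality for the restricted LP (LP_r) *)
definition LPr_feasible :: "nat \<Rightarrow> nat \<Rightarrow> (nat \<Rightarrow> (nat \<Rightarrow> real) set) \<Rightarrow> (nat \<Rightarrow> nat)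
       \<Rightarrow> (nat \<Rightarrow> nat \<Rightarrow> nat \<Rightarrow> real) \<Rightarrow> (nat \<Rightarrow> real) \<Rightarrow> (nat \<Rightarrow> real)
       \<Rightarrow> (nat \<Rightarrow> nat \<Rightarrow> real) \<Rightarrow> bool" where
  "LPr_feasible N S X n A b r z \<longleftrightarrow>
     (\<forall>i<N. z i \<in> conv (X i)) \<and> (\<forall>s<S. (\<Sum>i<N. dotp (n i) (A i s) (z i)) \<le> b s - r s)"

definition LPr_optimal :: "nat \<Rightarrow> nat \<Rightarrow> (nat \<Rightarrow> (nat \<Rightarrow> real) set) \<Rightarrow> (nat \<Rightarrow> nat)
       \<Rightarrow> (nat \<Rightarrow> nat \<Rightarrow> real) \<Rightarrow> (nat \<Rightarrow> nat \<Rightarrow> nat \<Rightarrow> real) \<Rightarrow> (nat \<Rightarrow> real) \<Rightarrow> (nat \<Rightarrow> real)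
       \<Rightarrow> (nat \<Rightarrow> nat \<Rightarrow> real) \<Rightarrow> bool" where
  "LPr_optimal N S X n c A b r z \<longleftrightarrow>
     LPr_feasible N S X n A b r z \<and>
     (\<forall>z'. LPr_feasible N S X n A b r z' \<longrightarrow>
        (\<Sum>i<N. dotp (n i) (c i) (z i)) \<le> (\<Sum>i<N. dotp (n i) (c i) (z' i)))"

(* Assumption A: LP_r feasible with unique optimal solution (uniqueness of the
   agent blocks z_1..z_N) *)
definition LPr_unique_opt :: "nat \<Rightarrow> nat \<Rightarrow> (nat \<Rightarrow> (nat \<Rightarrow> real) set) \<Rightarrow> (nat \<Rightarrow> nat)
       \<Rightarrow> (nat \<Rightarrow> nat \<Rightarrow> real) \<Rightarrow> (nat \<Rightarrow> nat \<Rightarrow> nat \<Rightarrow> real) \<Rightarrow> (nat \<Rightarrow> real) \<Rightarrow> (nat \<Rightarrow> real)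
       \<Rightarrow> bool" where
  "LPr_unique_opt N S X n c A b r \<longleftrightarrow>
     (\<exists>z. LPr_feasible N S X n A b r z) \<and>
     (\<exists>z. LPr_optimal N S X n c A b r z \<and>
        (\<forall>z'. LPr_optimal N S X n c A b r z' \<longrightarrow> (\<forall>i<N. z' i = z i)))"

(* ((z,v),mu) is a primal-dual optimal pair of the local LP (P1):
     minimize c^T z + M v  over z in conv X, v >= 0,  s.t. A z <= y + v 1,
   with mu the multiplier of the coupling constraint A z <= y + v 1
   (saddle point of the corresponding partial Lagrangian / KKT conditions). *)
definition P1_pd_opt :: "(nat \<Rightarrow> real) set \<Rightarrow> nat \<Rightarrow> nat \<Rightarrow> (nat \<Rightarrow> real)
       \<Rightarrow> (nat \<Rightarrow> nat \<Rightarrow> real) \<Rightarrow> real \<Rightarrow> (nat \<Rightarrow> real)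
       \<Rightarrow> (nat \<Rightarrow> real) \<Rightarrow> real \<Rightarrow> (nat \<Rightarrow> real) \<Rightarrow> bool" where
  "P1_pd_opt X n S c A M y z v mu \<longleftrightarrow>
     z \<in> conv X \<and> 0 \<le> v \<and> (\<forall>s<S. dotp n (A s) z \<le> y s + v) \<and>
     (\<forall>s<S. 0 \<le> mu s) \<and>
     (\<Sum>s<S. mu s * (dotp n (A s) z - y s - v)) = 0 \<and>
     (\<forall>z'\<in>conv X. \<forall>v'\<ge>0.
        dotp n c z + M * v + (\<Sum>s<S. mu s * (dotp n (A s) z - y s - v))
        \<le> dotp n c z' + M * v' + (\<Sum>s<S. mu s * (dotp n (A s) z' - y s - v')))"

(* x solves the lexicographic problem (P3): first minimize rho >= 0 subject to
   x in X, A x <= y + rho 1; then, with rho fixed at its minimum, minimize c^T x. *)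
definition P3_lexmin :: "(nat \<Rightarrow> real) set \<Rightarrow> nat \<Rightarrow> nat \<Rightarrow> (nat \<Rightarrow> real)
       \<Rightarrow> (nat \<Rightarrow> nat \<Rightarrow> real) \<Rightarrow> (nat \<Rightarrow> real) \<Rightarrow> (nat \<Rightarrow> real) \<Rightarrow> bool" where
  "P3_lexmin X n S c A y x \<longleftrightarrow>
     (\<exists>rho\<ge>0. x \<in> X \<and> (\<forall>s<S. dotp n (A s) x \<le> y s + rho) \<and>
        (\<forall>x'\<in>X. \<forall>rho'\<ge>0. (\<forall>s<S. dotp n (A s) x' \<le> y s + rho') \<longrightarrow> rho \<le> rho') \<and>
        (\<forall>x'\<in>X. (\<forall>s<S. dotp n (A s) x' \<le> y s + rho) \<longrightarrow> dotp n c x \<le> dotp n c x'))"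

(* a run of the distributed algorithm (P1)-(P3) with step sizes alpha,
   neighbour sets Nb and parameter M; sequences indexed by (t, i) *)
definition alg_run :: "nat \<Rightarrow> nat \<Rightarrow> (nat \<Rightarrow> (nat \<Rightarrow> real) set) \<Rightarrow> (nat \<Rightarrow> nat)
       \<Rightarrow> (nat \<Rightarrow> nat \<Rightarrow> real) \<Rightarrow> (nat \<Rightarrow> nat \<Rightarrow> nat \<Rightarrow> real)
       \<Rightarrow> (nat \<Rightarrow> nat set) \<Rightarrow> (nat \<Rightarrow> real) \<Rightarrow> real
       \<Rightarrow> (nat \<Rightarrow> nat \<Rightarrow> nat \<Rightarrow> real) \<Rightarrow> (nat \<Rightarrow> nat \<Rightarrow> nat \<Rightarrow> real) \<Rightarrow> (nat \<Rightarrow> nat \<Rightarrow> real)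
       \<Rightarrow> (nat \<Rightarrow> nat \<Rightarrow> nat \<Rightarrow> real) \<Rightarrow> (nat \<Rightarrow> nat \<Rightarrow> nat \<Rightarrow> real) \<Rightarrow> bool" where
  "alg_run N S X n c A Nb alpha M y z v mu x \<longleftrightarrow>
     (\<forall>t. \<forall>i<N.
        P1_pd_opt (X i) (n i) S (c i) (A i) M (y t i) (z t i) (v t i) (mu t i) \<and>
        (\<forall>s<S. y (Suc t) i s = y t i s + alpha t * (\<Sum>j\<in>Nb i. mu t i s - mu t j s)) \<and>
        P3_lexmin (X i) (n i) S (c i) (A i) (y t i) (x t i))"

end

theory Submission
  imports Defs
begin

text \<open>
  Let p_t be the total cost of the local solutions of (P1) at time t, penalties included. The
  multipliers are subgradients, so the exchanges along the edges of the graph form a subgradient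
  method: the squared distance of the accumulated exchanges to a flow realising an optimal
  allocation decreases up to a multiple of the squared step-size. As consecutive costs differ by
  O(alpha_t), p_t tends to the optimal value of the penalised problem, in which one scalar variable
  relaxes the restricted coupling constraint.

  Exactness of the penalty is not needed. By compactness of the sets conv X_i and uniqueness of the
  optimum z* of LP_r, for M large every near-optimal penalised solution has resource usage close to
  that of z* and a small violation; since delta > 0 is fixed, this suffices. By uniqueness, at most S
  blocks of z* lie outside X_i: with S + 1 such blocks, a linear dependence between the resource
  usages of feasible directions would move z* along a line of feasible points without increasing the
  cost. Eventually the block z*_i, when it lies in X_i, certifies a small violation in (P3), and
  otherwise x_i^L certifies one of at most max_i max_s (A_i^s x_i^L - L_i^s) up to a small error.
  The sum of the violations is thus at most sigma^ASY + delta.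
\<close>

subsection \<open>Compactness of convex hulls\<close>

lemma dotp_sum: "dotp n a (\<lambda>k. \<Sum>i\<in>I. u i * p i k) = (\<Sum>i\<in>I. u i * dotp n a (p i))"
  unfolding dotp_def sum_distrib_left
  by (subst sum.swap) (simp add: mult.left_commute)

lemma dotp_add_scaled: "dotp n a (\<lambda>k. x k + e * y k) = dotp n a x + e * dotp n a y"
  by (simp add: dotp_def sum.distrib sum_distrib_left algebra_simps)

lemma continuous_on_dotp [continuous_intros]:
  assumes "continuous_on T f"
  shows "continuous_on T (\<lambda>x. dotp n a (f x))"
proof -
  have "continuous_on T (\<lambda>x. f x k)" for k
    using assms by (rule continuous_on_product_then_coordinatewise)
  then show ?thesis
    unfolding dotp_def by (intro continuous_on_sum continuous_on_mult continuous_on_const)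
qed

text \<open>Gaussian elimination: a pivot \<open>p\<close> is solved from the last equation, and
  \<open>a'\<close> holds the coefficients of the other equations after this substitution. It later
  supplies the affine dependence in Caratheodory's argument and the dependence between perturbation
  directions.\<close>

lemma homogeneous_system_nontrivial:
  fixes a :: "'i \<Rightarrow> nat \<Rightarrow> real"
  assumes "finite I" "n < card I"
  shows "\<exists>l. (\<exists>i\<in>I. l i \<noteq> 0) \<and> (\<forall>s<n. (\<Sum>i\<in>I. l i * a i s) = 0)"
  using assms
proof (induction n arbitrary: I a)
  case 0
  then show ?case by (intro exI[of _ "\<lambda>_. 1"]) (auto simp: card_gt_0_iff)
next
  case (Suc n)
  show ?case
  proof (cases "\<forall>i\<in>I. a i n = 0")
    case True
    moreover obtain l where "\<exists>i\<in>I. l i \<noteq> 0" "\<forall>s<n. (\<Sum>i\<in>I. l i * a i s) = 0"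
      using Suc.IH[of I a] Suc.prems Suc_lessD by blast
    ultimately show ?thesis by (intro exI[of _ l]) (simp add: less_Suc_eq)
  next
    case False
    then obtain p where p: "p \<in> I" "a p n \<noteq> 0" by blast
    define J where "J = I - {p}"
    define a' where "a' i s = a i s - a i n / a p n * a p s" for i s
    have J: "finite J" "n < card J" "p \<notin> J" "I = insert p J"
      using Suc.prems p by (auto simp: J_def)
    obtain l where l: "\<exists>i\<in>J. l i \<noteq> 0" "\<And>s. s < n \<Longrightarrow> (\<Sum>i\<in>J. l i * a' i s) = 0"
      using Suc.IH[OF J(1,2), of a'] by blast
    define q where "q = - (\<Sum>i\<in>J. l i * a i n) / a p n"
    define l' where "l' = l(p := q)"
    have sum_l': "(\<Sum>i\<in>I. l' i * a i s) = q * a p s + (\<Sum>i\<in>J. l i * a i s)" for s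
    proof -
      have "(\<Sum>i\<in>J. l' i * a i s) = (\<Sum>i\<in>J. l i * a i s)"
        using J by (intro sum.cong) (auto simp: l'_def)
      then show ?thesis using J by (simp add: l'_def)
    qed
    have "(\<Sum>i\<in>I. l' i * a i s) = 0" if "s < Suc n" for s
    proof (cases "s = n")
      case True
      then show ?thesis using p by (simp add: sum_l' q_def)
    next
      case False
      then have "(\<Sum>i\<in>J. l i * a i s) - (\<Sum>i\<in>J. l i * a i n) / a p n * a p s = 0"
        using that l(2)[of s]
        by (simp add: a'_def algebra_simps sum_subtractf sum_divide_distrib sum_distrib_left)
      then show ?thesis by (simp add: sum_l' q_def)
    qed
    moreover have "\<exists>i\<in>I. l' i \<noteq> 0"
      using l(1) J by (auto simp: l'_def)
    ultimately show ?thesis by blast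
  qed
qed

lemma subset_conv: "S \<subseteq> conv S"
proof
  fix x assume "x \<in> S"
  then show "x \<in> conv S"
    unfolding conv_def by (auto intro!: exI[of _ "{x}"] exI[of _ "\<lambda>_. 1"])
qed

lemma dotp_conv_ge:
  assumes "z \<in> conv S" "\<And>x. x \<in> S \<Longrightarrow> l \<le> dotp n a x"
  shows "l \<le> dotp n a z"
proof -
  obtain F u where F: "finite F" "F \<subseteq> S" "\<forall>y\<in>F. 0 \<le> u y" "sum u F = 1"
    and z: "z = (\<lambda>k. \<Sum>y\<in>F. u y * y k)"
    using assms(1) unfolding conv_def by blast
  have "l = (\<Sum>y\<in>F. u y * l)"
    using F by (simp flip: sum_distrib_right)
  also have "\<dots> \<le> (\<Sum>y\<in>F. u y * dotp n a y)"
    using F assms(2) by (intro sum_mono mult_left_mono) auto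
  finally show ?thesis by (simp add: z dotp_sum)
qed

text \<open>A representation with the fewest points is affinely independent: otherwise a dependence
  could be subtracted until one weight vanishes. As all points live in the first \<open>n\<close>
  coordinates, at most \<open>n + 1\<close> of them are affinely independent.\<close>

lemma caratheodory_conv:
  assumes z: "z \<in> conv S" and supp: "\<And>x k. x \<in> S \<Longrightarrow> n \<le> k \<Longrightarrow> x k = 0"
  obtains F u where "finite F" "F \<subseteq> S" "card F \<le> Suc n" "\<forall>y\<in>F. 0 \<le> u y" "sum u F = 1"
    "z = (\<lambda>k. \<Sum>y\<in>F. u y * y k)"
proof -
  define P where "P F \<longleftrightarrow> finite F \<and> F \<subseteq> S \<and>
    (\<exists>u. (\<forall>y\<in>F. 0 \<le> u y) \<and> sum u F = 1 \<and> z = (\<lambda>k. \<Sum>y\<in>F. u y * y k))" for F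
  obtain F0 where "P F0" using z unfolding conv_def P_def by blast
  then obtain F where PF: "P F" and min: "\<And>G. P G \<Longrightarrow> card F \<le> card G"
    using ex_has_least_nat[of P F0 card] by blast
  from PF obtain u where F: "finite F" "F \<subseteq> S" "\<forall>y\<in>F. 0 \<le> u y" "sum u F = 1"
    and zF: "z = (\<lambda>k. \<Sum>y\<in>F. u y * y k)"
    unfolding P_def by blast
  have "card F \<le> Suc n"
  proof (rule ccontr)
    assume "\<not> card F \<le> Suc n"
    \<comment> \<open>The equation with index \<open>n\<close> has all coefficients 1, so
      \<open>l\<close> sums to zero and is an affine dependence.\<close>
    then obtain l where l: "\<exists>y\<in>F. l y \<noteq> 0"
      "\<forall>k<Suc n. (\<Sum>y\<in>F. l y * (if k < n then y k else 1)) = 0"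
      using homogeneous_system_nontrivial[OF F(1), of "Suc n" "\<lambda>y k. if k < n then y k else 1"]
      by auto
    have l0: "sum l F = 0" using l(2)[rule_format, of n] by simp
    have lk: "(\<Sum>y\<in>F. l y * y k) = 0" for k
    proof (cases "k < n")
      case True then show ?thesis using l(2)[rule_format, of k] by simp
    next
      case False then show ?thesis using F supp by (intro sum.neutral) (auto simp: subset_iff)
    qed
    have "\<exists>y\<in>F. 0 < l y"
    proof (rule ccontr)
      assume "\<not> ?thesis"
      then have "\<forall>y\<in>F. 0 \<le> - l y" by force
      moreover have "sum (\<lambda>y. - l y) F = 0" using l0 by (simp add: sum_negf)
      ultimately have "\<forall>y\<in>F. - l y = 0" using F(1) by (subst (asm) sum_nonneg_eq_0_iff) auto
      then show False using l(1) by auto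
    qed
    then have fin: "finite {y \<in> F. 0 < l y}" "{y \<in> F. 0 < l y} \<noteq> {}"
      using F(1) by auto
    \<comment> \<open>Ratio test: the least \<open>u y / l y\<close> over positive
      \<open>l y\<close> is the longest step along \<open>- l\<close> that keeps all weights
      nonnegative, and it brings the weight of \<open>p\<close> to zero.\<close>
    define p where "p = arg_min_on (\<lambda>y. u y / l y) {y \<in> F. 0 < l y}"
    have p: "p \<in> F" "0 < l p"
      using arg_min_if_finite(1)[OF fin] by (auto simp: p_def)
    have pmin: "u p / l p \<le> u y / l y" if "y \<in> F" "0 < l y" for y
      using arg_min_least[OF fin, of y "\<lambda>y. u y / l y"] that by (auto simp: p_def)
    define w where "w y = u y - u p / l p * l y" for y
    have wp: "w p = 0" using p by (simp add: w_def)
    have w_nonneg: "0 \<le> w y" if "y \<in> F" for y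
    proof (cases "0 < l y")
      case True
      then show ?thesis using pmin[OF that] by (simp add: w_def field_simps)
    next
      case False
      then have "u p / l p * l y \<le> 0" using p F by (intro mult_nonneg_nonpos) auto
      moreover have "0 \<le> u y" using F(3) that by blast
      ultimately show ?thesis by (simp add: w_def)
    qed
    have "sum w F = 1"
      using F(4) l0 unfolding w_def sum_subtractf sum_distrib_left[symmetric] by simp
    then have "sum w (F - {p}) = 1" using F(1) p wp by (simp add: sum_diff1)
    moreover have "(\<Sum>y\<in>F - {p}. w y * y k) = z k" for k
    proof -
      have "(\<Sum>y\<in>F - {p}. w y * y k) = (\<Sum>y\<in>F. w y * y k)"
        using F(1) p wp by (simp add: sum_diff1)
      also have "\<dots> = z k - u p / l p * (\<Sum>y\<in>F. l y * y k)"
        by (simp add: w_def zF left_diff_distrib sum_subtractf sum_distrib_left mult.assoc)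
      finally show ?thesis by (simp add: lk)
    qed
    ultimately have "P (F - {p})"
      unfolding P_def using F w_nonneg by (intro conjI exI[of _ w]) (auto simp: fun_eq_iff)
    from min[OF this] show False using p F(1) using card_Diff1_less[of F p] by linarith
  qed
  then show ?thesis using that F zF by blast
qed

text \<open>Combinations of at most \<open>j + 1\<close> points, built by adjoining one point at a
  time. Each level is a continuous image of a product, so compactness passes from level to
  level.\<close>

fun joins :: "(nat \<Rightarrow> real) set \<Rightarrow> nat \<Rightarrow> (nat \<Rightarrow> real) set" where
  "joins S 0 = S"
| "joins S (Suc j) = (\<lambda>(t, x, y) k. (1 - t) * x k + t * y k) ` ({0..1} \<times> S \<times> joins S j)"

lemma joins_SucI:
  assumes "0 \<le> t" "t \<le> 1" "x \<in> S" "y \<in> joins S j"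
    "\<And>k. z k = (1 - t) * x k + t * y k"
  shows "z \<in> joins S (Suc j)"
proof -
  have "z = (\<lambda>k. (1 - t) * x k + t * y k)" using assms(5) by (simp add: fun_eq_iff)
  then show ?thesis using assms(1-4) by (auto intro!: image_eqI[of _ _ "(t, x, y)"])
qed

lemma subset_joins: "S \<subseteq> joins S j"
proof (induction j)
  case (Suc j)
  show ?case
  proof
    fix x assume "x \<in> S"
    with Suc show "x \<in> joins S (Suc j)" by (intro joins_SucI[of 0 x S x]) auto
  qed
qed simp

lemma compact_joins:
  assumes "compact S"
  shows "compact (joins S j)"
proof (induction j)
  case (Suc j)
  let ?T = "{0..1} \<times> S \<times> joins S j"
  have "continuous_on ?T (\<lambda>q. fst (snd q) k)" "continuous_on ?T (\<lambda>q. snd (snd q) k)" for k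
    by (rule continuous_on_product_then_coordinatewise,
        intro continuous_on_fst continuous_on_snd continuous_on_id)+
  then have "continuous_on ?T (\<lambda>(t, x, y) k. (1 - t) * x k + t * y k :: real)"
    unfolding case_prod_unfold
    by (intro continuous_on_coordinatewise_then_product continuous_on_add continuous_on_mult
        continuous_on_diff continuous_on_const continuous_on_fst continuous_on_id)
  with Suc assms show ?case
    unfolding joins.simps by (intro compact_continuous_image compact_Times) auto
qed (simp add: assms)

lemma joins_subset_conv: "joins S j \<subseteq> conv S"
proof (induction j)
  case 0 show ?case using subset_conv by simp
next
  case (Suc j)
  show ?case
  proof
    fix z assume "z \<in> joins S (Suc j)"
    then obtain t x y where t: "0 \<le> t" "t \<le> 1" and x: "x \<in> S" and y: "y \<in> joins S j"
      and z: "z = (\<lambda>k. (1 - t) * x k + t * y k)" by auto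
    obtain F u where F: "finite F" "F \<subseteq> S" "\<forall>p\<in>F. 0 \<le> u p" "sum u F = 1"
      and yF: "y = (\<lambda>k. \<Sum>p\<in>F. u p * p k)"
      using y Suc unfolding conv_def by blast
    \<comment> \<open>The point \<open>x\<close> may already belong to \<open>F\<close>; its two
      contributions are then added up.\<close>
    define w where "w p = (if p = x then 1 - t else 0) + t * (if p \<in> F then u p else 0)" for p
    have w: "(\<Sum>p\<in>insert x F. w p * h p) = (1 - t) * h x + t * (\<Sum>p\<in>F. u p * h p)" for h :: "_ \<Rightarrow> real"
    proof -
      have "(\<Sum>p\<in>insert x F. w p * h p) =
          (\<Sum>p\<in>insert x F. if p = x then (1 - t) * h p else 0) +
          t * (\<Sum>p\<in>insert x F. if p \<in> F then u p * h p else 0)"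
        unfolding sum_distrib_left sum.distrib[symmetric] w_def
        by (intro sum.cong) (auto simp: algebra_simps)
      also have "(\<Sum>p\<in>insert x F. if p \<in> F then u p * h p else 0) = (\<Sum>p\<in>F. u p * h p)"
        using F(1) by (subst sum.inter_restrict[symmetric]) (auto intro!: sum.cong)
      finally show ?thesis using F(1) by simp
    qed
    have "sum w (insert x F) = 1" using w[of "\<lambda>_. 1"] F by simp
    moreover have "z = (\<lambda>k. \<Sum>p\<in>insert x F. w p * p k)"
      using w by (simp add: z yF)
    moreover have "\<forall>p\<in>insert x F. 0 \<le> w p" using t F by (auto simp: w_def)
    ultimately show "z \<in> conv S"
      unfolding conv_def using F x by blast
  qed
qed

text \<open>One point \<open>p\<close> is split off and the remaining weights are rescaled by
  \<open>1 - u p\<close>. If \<open>u p = 1\<close>, rescaling is impossible, but the combination is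
  then \<open>p\<close> itself.\<close>

lemma convex_combination_in_joins:
  assumes "finite F" "F \<subseteq> S" "card F \<le> Suc j" "\<forall>y\<in>F. 0 \<le> u y" "sum u F = 1"
  shows "(\<lambda>k. \<Sum>y\<in>F. u y * y k) \<in> joins S j"
  using assms
proof (induction j arbitrary: F u)
  case 0
  then have "card F = 1" by (cases "F = {}") (auto simp: Suc_le_eq le_Suc_eq)
  then obtain p where "F = {p}" by (auto simp: card_1_singleton_iff)
  with 0 show ?case by auto
next
  case (Suc j)
  obtain p where p: "p \<in> F" using Suc.prems by fastforce
  define G where "G = F - {p}"
  have G: "finite G" "G \<subseteq> S" "card G \<le> Suc j" "p \<notin> G" "F = insert p G"
    using Suc.prems p by (auto simp: G_def)
  have up: "sum u G = 1 - u p" "0 \<le> u p" "0 \<le> sum u G"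
    using Suc.prems G by (auto intro!: sum_nonneg)
  show ?case
  proof (cases "u p = 1")
    case True
    then have "\<forall>y\<in>G. u y = 0"
      using up G Suc.prems(4) by (intro sum_nonneg_eq_0_iff[THEN iffD1]) auto
    then have "(\<Sum>y\<in>F. u y * y k) = p k" for k using G True by simp
    then show ?thesis using p Suc.prems subset_joins[of S j]
      by (intro joins_SucI[of 0 p _ p]) auto
  next
    case False
    define t where "t = 1 - u p"
    have t: "0 < t" "t \<le> 1" using False up by (auto simp: t_def)
    have "(\<lambda>k. \<Sum>y\<in>G. (u y / t) * y k) \<in> joins S j"
      using G up t Suc.prems(4)
      by (intro Suc.IH) (auto simp: t_def simp flip: sum_divide_distrib)
    moreover have "(\<Sum>y\<in>F. u y * y k) = (1 - t) * p k + t * (\<Sum>y\<in>G. (u y / t) * y k)" for k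
      using t G by (simp add: sum_distrib_left) (simp add: t_def)
    ultimately show ?thesis
      using t p Suc.prems(2) by (intro joins_SucI[of t p S _ j]) auto
  qed
qed

text \<open>Caratheodory's bound makes the single level \<open>joins S n\<close> exhaust the whole
  hull.\<close>

lemma compact_conv:
  assumes "compact S" "\<And>x k. x \<in> S \<Longrightarrow> n \<le> k \<Longrightarrow> x k = 0"
  shows "compact (conv S)"
proof -
  have "conv S \<subseteq> joins S n"
  proof
    fix z assume "z \<in> conv S"
    then obtain F u where "finite F" "F \<subseteq> S" "card F \<le> Suc n" "\<forall>y\<in>F. 0 \<le> u y" "sum u F = 1"
      "z = (\<lambda>k. \<Sum>y\<in>F. u y * y k)"
      using caratheodory_conv[of z S n] assms(2) by blast
    then show "z \<in> joins S n" using convex_combination_in_joins by simp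
  qed
  then have "conv S = joins S n" using joins_subset_conv by blast
  then show ?thesis using compact_joins[OF assms(1)] by simp
qed

text \<open>A point outside \<open>S\<close> differs from every generator \<open>p\<close> in its
  representation. Weight can be shifted towards \<open>p\<close> and, since \<open>u p\<close> is
  positive, also away from it, which gives a two-sided segment inside the hull.\<close>

lemma conv_perturb:
  assumes z: "z \<in> conv S" "z \<notin> S"
  obtains dir e where "0 < e" "dir \<noteq> (\<lambda>_. 0)"
    "\<And>h. \<bar>h\<bar> \<le> e \<Longrightarrow> (\<lambda>k. z k + h * dir k) \<in> conv S"
proof -
  obtain F u where F: "finite F" "F \<subseteq> S" "\<forall>y\<in>F. 0 \<le> u y" "sum u F = 1"
    and zF: "z = (\<lambda>k. \<Sum>y\<in>F. u y * y k)"
    using z(1) unfolding conv_def by blast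
  obtain p where "p \<in> F" "u p \<noteq> 0"
    using F(4) sum.neutral[of F u] by (metis zero_neq_one)
  with F(3) have p: "p \<in> F" "0 < u p" by (auto simp: order_less_le)
  \<comment> \<open>The bound 1 keeps the factor \<open>1 - h\<close> nonnegative when moving
    towards \<open>p\<close>; the bound \<open>u p / 2\<close> keeps the weight of \<open>p\<close>
    positive when moving away.\<close>
  define e where "e = min 1 (u p / 2)"
  have up1: "u p \<le> 1" using F p member_le_sum[of p F u] by auto
  have "(\<lambda>k. z k + h * (p k - z k)) \<in> conv S" if "\<bar>h\<bar> \<le> e" for h
  proof -
    define w where "w y = (1 - h) * u y + (if y = p then h else 0)" for y
    have "0 \<le> w y" if "y \<in> F" for y
    proof -
      have "0 \<le> u y" using F that by blast
      show ?thesis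
      proof (cases "y = p")
        case True
        show ?thesis
        proof (cases "0 \<le> h")
          case False
          then have "u p \<le> (1 - h) * u p" using p by (simp add: algebra_simps mult_nonpos_nonneg)
          moreover have "- h \<le> u p / 2" using \<open>\<bar>h\<bar> \<le> e\<close> by (auto simp: e_def)
          ultimately have "0 \<le> (1 - h) * u p + h" using p by linarith
          then show ?thesis using True by (simp add: w_def)
        qed (use \<open>0 \<le> u y\<close> \<open>\<bar>h\<bar> \<le> e\<close> in \<open>auto simp: w_def e_def\<close>)
      qed (use \<open>0 \<le> u y\<close> \<open>\<bar>h\<bar> \<le> e\<close> in \<open>auto simp: w_def e_def\<close>)
    qed
    moreover have w: "(\<Sum>y\<in>F. w y * g y) = (1 - h) * (\<Sum>y\<in>F. u y * g y) + h * g p" for g :: "_ \<Rightarrow> real"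
    proof -
      have "(\<Sum>y\<in>F. w y * g y) = (1 - h) * (\<Sum>y\<in>F. u y * g y) + (\<Sum>y\<in>F. if y = p then h * g y else 0)"
        unfolding sum_distrib_left sum.distrib[symmetric] w_def
        by (intro sum.cong) (auto simp: algebra_simps)
      then show ?thesis using F(1) p by simp
    qed
    moreover have "sum w F = 1" using w[of "\<lambda>_. 1"] F by simp
    moreover have "(\<lambda>k. z k + h * (p k - z k)) = (\<lambda>k. \<Sum>y\<in>F. w y * y k)"
      unfolding w by (simp add: zF algebra_simps)
    ultimately show ?thesis unfolding conv_def using F by blast
  qed
  moreover have "0 < e" using p by (simp add: e_def)
  moreover have "(\<lambda>k. p k - z k) \<noteq> (\<lambda>_. 0)"
  proof
    assume "(\<lambda>k. p k - z k) = (\<lambda>_. 0)"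
    then have "p = z" by (simp add: fun_eq_iff)
    then show False using z p F by blast
  qed
  ultimately show ?thesis using that by blast
qed

subsection \<open>Penalties and weighted sums\<close>

text \<open>A compactness argument: outside \<open>U\<close>, each point of \<open>K\<close> either
  exceeds \<open>c\<close> with no violation or has a positive violation that a large penalty
  magnifies. A finite subcover makes penalty and margin uniform.\<close>

lemma penalty_localization:
  fixes F w :: "'a::topological_space \<Rightarrow> real"
  assumes "compact K" "continuous_on UNIV F" "continuous_on UNIV w" "\<And>z. z \<in> K \<Longrightarrow> 0 \<le> w z"
    "open U" and U: "\<And>z. z \<in> K \<Longrightarrow> w z = 0 \<Longrightarrow> F z \<le> c \<Longrightarrow> z \<in> U"
  obtains M0 \<eta> :: real where "0 < M0" "0 < \<eta>" "\<eta> \<le> 1"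
    "\<And>M z. M0 \<le> M \<Longrightarrow> z \<in> K \<Longrightarrow> F z + M * w z < c + \<eta> \<Longrightarrow> z \<in> U"
proof -
  \<comment> \<open>Penalty and margin share the index \<open>k\<close>, so on \<open>K\<close>
    these sets grow with \<open>k\<close> and the largest index of a finite subcover serves for all
    points.\<close>
  define G where "G k = {z. c + 1 / real (Suc k) < F z + real (Suc k) * w z}" for k
  have opn: "open (G k)" if "k \<in> UNIV" for k
    unfolding G_def using assms by (intro open_Collect_less continuous_intros) auto
  have cover: "K - U \<subseteq> (\<Union>k\<in>UNIV. G k)"
  proof
    fix z assume z: "z \<in> K - U"
    show "z \<in> (\<Union>k\<in>UNIV. G k)"
    proof (cases "w z = 0")
      case True
      then have "0 < F z - c" using U z by force
      then obtain k where "1 / real (Suc k) < F z - c"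
        using nat_approx_posE by blast
      then have "z \<in> G k" using True by (simp add: G_def)
      then show ?thesis by blast
    next
      case False
      then have "0 < w z" using assms(4)[of z] z by auto
      then obtain k where k: "c + 1 - F z < real k * w z"
        using ex_less_of_nat_mult by blast
      have "real k * w z \<le> real (Suc k) * w z" using \<open>0 < w z\<close> by (intro mult_right_mono) auto
      moreover have "1 / real (Suc k) \<le> 1" by simp
      ultimately have "c + 1 / real (Suc k) < F z + real (Suc k) * w z" using k by linarith
      then have "z \<in> G k" by (simp add: G_def)
      then show ?thesis by blast
    qed
  qed
  have cpt: "compact (K - U)" using assms(1,5) by (rule compact_diff)
  obtain C where C: "finite C" "K - U \<subseteq> (\<Union>k\<in>C. G k)"
    using compactE_image[OF cpt opn cover] by metis
  obtain m where m: "\<And>k. k \<in> C \<Longrightarrow> k \<le> m"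
    using C(1) finite_nat_set_iff_bounded_le by auto
  show ?thesis
  proof (rule that[of "real (Suc m)" "1 / real (Suc m)"])
    fix M z assume M: "real (Suc m) \<le> M" and z: "z \<in> K" "F z + M * w z < c + 1 / real (Suc m)"
    show "z \<in> U"
    proof (rule ccontr)
      assume "z \<notin> U"
      then obtain k where k: "k \<in> C" "z \<in> G k" using z C by blast
      have "1 / real (Suc m) \<le> 1 / real (Suc k)" using m[OF k(1)] by (intro divide_left_mono) auto
      moreover have "real (Suc k) * w z \<le> M * w z"
        using m[OF k(1)] M assms(4)[OF z(1)] by (intro mult_right_mono) auto
      ultimately show False using k(2) z(2) unfolding G_def by simp
    qed
  qed auto
qed

text \<open>The increments \<open>B * a t\<close> of \<open>q\<close> need not be summable, but
  those of its square are bounded by the summable \<open>e\<close>. Hence the square converges, and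
  a positive limit would make \<open>a\<close> summable, against \<open>diverges\<close>.\<close>

lemma tendsto_zero_of_summable_weighted:
  fixes q a :: "nat \<Rightarrow> real"
  assumes q: "\<And>t. 0 \<le> q t" and a: "\<And>t. 0 \<le> a t"
    and diverges: "filterlim (\<lambda>T. \<Sum>t<T. a t) at_top sequentially"
    and sq: "summable (\<lambda>t. (a t)\<^sup>2)" and aq: "summable (\<lambda>t. a t * q t)"
    and step: "\<And>t. q (Suc t) \<le> q t + B * a t" and "0 \<le> B"
  shows "q \<longlonglongrightarrow> 0"
proof -
  define e where "e t = 2 * B * (a t * q t) + B\<^sup>2 * (a t)\<^sup>2" for t
  have e: "summable e" unfolding e_def by (intro summable_add summable_mult aq sq)
  have e_nonneg: "0 \<le> e t" for t using q a \<open>0 \<le> B\<close> by (simp add: e_def)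
  \<comment> \<open>Removing the accumulated increments leaves a nonincreasing sequence that is
    bounded below.\<close>
  define r where "r t = (q t)\<^sup>2 - (\<Sum>\<tau><t. e \<tau>)" for t
  have "(q (Suc t))\<^sup>2 \<le> (q t + B * a t)\<^sup>2" for t
    using step q by (intro power_mono) auto
  then have "(q (Suc t))\<^sup>2 \<le> (q t)\<^sup>2 + e t" for t
    by (simp add: e_def power2_sum power_mult_distrib algebra_simps)
  then have "r (Suc t) \<le> r t" for t by (simp add: r_def algebra_simps)
  then have "decseq r" by (rule decseq_SucI)
  moreover have "- suminf e \<le> r t" for t
  proof -
    have "(\<Sum>\<tau><t. e \<tau>) \<le> suminf e" using e_nonneg by (intro sum_le_suminf[OF e]) auto
    then show ?thesis using zero_le_power2[of "q t"] unfolding r_def by linarith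
  qed
  ultimately obtain R where "r \<longlonglongrightarrow> R" using decseq_convergent[of r "- suminf e"] by blast
  then have "(\<lambda>t. r t + (\<Sum>\<tau><t. e \<tau>)) \<longlonglongrightarrow> R + suminf e"
    using summable_LIMSEQ[OF e] by (rule tendsto_add)
  then have "(\<lambda>t. sqrt ((q t)\<^sup>2)) \<longlonglongrightarrow> sqrt (R + suminf e)"
    unfolding r_def by (intro tendsto_real_sqrt) simp
  then obtain l where l: "q \<longlonglongrightarrow> l" using q by auto
  have "0 \<le> l" using l q by (intro LIMSEQ_le_const[OF l]) auto
  have "l = 0"
  proof (rule ccontr)
    assume "l \<noteq> 0"
    with \<open>0 \<le> l\<close> have "0 < l" by simp
    then have "eventually (\<lambda>t. l / 2 < q t) sequentially"
      using order_tendstoD(1)[OF l, of "l / 2"] by simp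
    then have "eventually (\<lambda>t. norm (a t) \<le> 2 / l * (a t * q t)) sequentially"
    proof eventually_elim
      case (elim t)
      have "a t * (l / 2) \<le> a t * q t" using elim a[of t] by (intro mult_left_mono) auto
      then show ?case using \<open>0 < l\<close> a[of t] by (simp add: field_simps)
    qed
    then have "summable a"
      using summable_mult[OF aq] by (rule summable_comparison_test_ev)
    from summable_LIMSEQ[OF this] show False
      using not_tendsto_and_filterlim_at_infinity[OF _ _ filterlim_at_top_imp_at_infinity[OF diverges]]
      by auto
  qed
  with l show ?thesis by simp
qed

subsection \<open>Flows on connected graphs\<close>

lemma connected_undirectedD:
  assumes "connected_undirected N Nb" "i < N"
  shows "j \<in> Nb i \<Longrightarrow> j < N" "j \<in> Nb i \<Longrightarrow> i \<in> Nb j" "finite (Nb i)"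
    "j < N \<Longrightarrow> (i, j) \<in> {(a, b). a < N \<and> b \<in> Nb a}\<^sup>*"
proof -
  have sub: "Nb i \<subseteq> {0..<N}" and sym: "\<forall>j<N. j \<in> Nb i \<longleftrightarrow> i \<in> Nb j"
    and conn: "\<forall>j<N. (i, j) \<in> {(a, b). a < N \<and> b \<in> Nb a}\<^sup>*"
    using assms unfolding connected_undirected_def by blast+
  show "j < N" if "j \<in> Nb i" using sub that by auto
  then show "i \<in> Nb j" if "j \<in> Nb i" using sym that by blast
  show "finite (Nb i)" using sub finite_subset by blast
  show "(i, j) \<in> {(a, b). a < N \<and> b \<in> Nb a}\<^sup>*" if "j < N" using conn that by blast
qed

text \<open>Induction along the path: a unit flow over the new edge moves the sink from
  \<open>b\<close> to \<open>c\<close>.\<close>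

lemma path_unit_flow:
  assumes graph: "connected_undirected N Nb"
    and path: "(a, b) \<in> {(a, b). a < N \<and> b \<in> Nb a}\<^sup>*"
  shows "\<exists>f :: nat \<Rightarrow> nat \<Rightarrow> real. (\<forall>i j. f j i = - f i j) \<and>
    (\<forall>i<N. (\<Sum>j\<in>Nb i. f i j) = of_bool (i = a) - of_bool (i = b))"
  using path
proof (induction rule: rtrancl_induct)
  case base
  show ?case by (intro exI[of _ "\<lambda>_ _. 0"]) simp
next
  case (step b c)
  then obtain f :: "nat \<Rightarrow> nat \<Rightarrow> real" where f: "\<And>i j. f j i = - f i j"
    "\<And>i. i < N \<Longrightarrow> (\<Sum>j\<in>Nb i. f i j) = of_bool (i = a) - of_bool (i = b)" by blast
  from step(2) have "b < N" "c \<in> Nb b" by auto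
  with connected_undirectedD(1,2)[OF graph this(1)]
  have bc: "c < N" "c \<in> Nb b" "b \<in> Nb c" by auto
  define g :: "nat \<Rightarrow> nat \<Rightarrow> real"
    where "g i j = of_bool (i = b \<and> j = c) - of_bool (i = c \<and> j = b)" for i j
  have "(\<Sum>j\<in>Nb i. g i j) = of_bool (i = b) - of_bool (i = c)" if "i < N" for i
  proof -
    have "finite (Nb i)"
      using connected_undirectedD(3)[OF graph that] .
    then have "(\<Sum>j\<in>Nb i. if j = k then x else 0) = (if k \<in> Nb i then x else 0)" for k and x :: real
      by simp
    moreover have "(\<Sum>j\<in>Nb i. g i j) =
        (\<Sum>j\<in>Nb i. if j = c then of_bool (i = b) else 0) - (\<Sum>j\<in>Nb i. if j = b then of_bool (i = c) else 0)"
      unfolding g_def sum_subtractf[symmetric] by (intro sum.cong) auto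
    ultimately show ?thesis using bc by auto
  qed
  then have "\<forall>i<N. (\<Sum>j\<in>Nb i. f i j + g i j) = of_bool (i = a) - of_bool (i = c)"
    using f(2) by (simp add: sum.distrib)
  moreover have "f j i + g j i = - (f i j + g i j)" for i j
    using f(1)[of i j] by (simp add: g_def conj_commute)
  ultimately show ?case by (intro exI[of _ "\<lambda>i j. f i j + g i j"]) blast
qed

text \<open>Unit flows from every agent \<open>a\<close> to agent 0 are superposed with weights
  \<open>g a\<close>; what arrives at agent 0 cancels because \<open>g\<close> sums to zero.\<close>

lemma flow_with_divergence:
  fixes g :: "nat \<Rightarrow> real"
  assumes graph: "connected_undirected N Nb" and g: "(\<Sum>i<N. g i) = 0"
  shows "\<exists>f. (\<forall>i j. f j i = - f i j) \<and> (\<forall>i<N. (\<Sum>j\<in>Nb i. f i j) = g i)"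
proof -
  have "\<exists>f :: nat \<Rightarrow> nat \<Rightarrow> real. (\<forall>i j. f j i = - f i j) \<and>
      (\<forall>i<N. (\<Sum>j\<in>Nb i. f i j) = of_bool (i = a) - of_bool (i = 0))" if "a < N" for a
    using that by (intro path_unit_flow[OF graph] connected_undirectedD(4)[OF graph]) auto
  then obtain f :: "nat \<Rightarrow> nat \<Rightarrow> nat \<Rightarrow> real" where f: "\<And>a i j. a < N \<Longrightarrow> f a j i = - f a i j"
    "\<And>a i. a < N \<Longrightarrow> i < N \<Longrightarrow> (\<Sum>j\<in>Nb i. f a i j) = of_bool (i = a) - of_bool (i = 0)"
    by metis
  define h where "h i j = (\<Sum>a<N. g a * f a i j)" for i j
  have "(\<Sum>j\<in>Nb i. h i j) = g i" if "i < N" for i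
  proof -
    have "(\<Sum>j\<in>Nb i. h i j) = (\<Sum>a<N. g a * (\<Sum>j\<in>Nb i. f a i j))"
      unfolding h_def sum_distrib_left by (rule sum.swap)
    also have "\<dots> = (\<Sum>a<N. g a * (of_bool (i = a) - of_bool (i = 0)))"
      using f(2) that by (intro sum.cong) auto
    also have "\<dots> = (\<Sum>a<N. if i = a then g a else 0) - (\<Sum>a<N. g a) * of_bool (i = 0)"
      unfolding sum_distrib_right sum_subtractf[symmetric] by (intro sum.cong) auto
    finally show ?thesis using that g by simp
  qed
  moreover have "h j i = - h i j" for i j
    unfolding h_def sum_negf[symmetric] by (intro sum.cong) (auto simp: f(1)[of _ j i])
  ultimately show ?thesis by blast
qed

lemma neighbour_sum_swap:
  fixes h :: "nat \<Rightarrow> nat \<Rightarrow> real"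
  assumes graph: "connected_undirected N Nb"
  shows "(\<Sum>i<N. \<Sum>j\<in>Nb i. h i j) = (\<Sum>i<N. \<Sum>j\<in>Nb i. h j i)"
proof -
  have Nb: "Nb i = {j \<in> {..<N}. j \<in> Nb i}" "Nb i = {j \<in> {..<N}. i \<in> Nb j}" if "i < N" for i
    using connected_undirectedD[OF graph] that by blast+
  have "(\<Sum>i<N. \<Sum>j\<in>Nb i. h i j) = (\<Sum>i<N. \<Sum>j\<in>{j \<in> {..<N}. j \<in> Nb i}. h i j)"
    using Nb(1) by (intro sum.cong) auto
  also have "\<dots> = (\<Sum>j<N. \<Sum>i\<in>{i \<in> {..<N}. j \<in> Nb i}. h i j)"
    by (rule sum.swap_restrict) auto
  also have "\<dots> = (\<Sum>j<N. \<Sum>i\<in>Nb j. h i j)"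
    using Nb(2) by (intro sum.cong) auto
  finally show ?thesis .
qed

text \<open>Summation by parts on the graph; the factor 2 arises because every edge is counted in
  both directions.\<close>

lemma neighbour_sum_antisym:
  fixes f :: "nat \<Rightarrow> nat \<Rightarrow> real"
  assumes graph: "connected_undirected N Nb" and f: "\<And>i j. f j i = - f i j"
  shows "(\<Sum>i<N. \<Sum>j\<in>Nb i. (p i - p j) * f i j) = 2 * (\<Sum>i<N. p i * (\<Sum>j\<in>Nb i. f i j))"
proof -
  have "(\<Sum>i<N. \<Sum>j\<in>Nb i. p j * f i j) = (\<Sum>i<N. \<Sum>j\<in>Nb i. p i * f j i)"
    by (rule neighbour_sum_swap[OF graph])
  also have "\<dots> = - (\<Sum>i<N. \<Sum>j\<in>Nb i. p i * f i j)"
    unfolding sum_negf[symmetric] by (subst f) simp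
  finally show ?thesis
    by (simp add: left_diff_distrib sum_subtractf sum_distrib_left)
qed

subsection \<open>Blocks of the unique optimum outside the mixed-integer sets\<close>

lemma card_fractional_blocks_le:
  assumes opt: "LPr_optimal N S X n c A b r z"
    and unique: "\<And>z' i. LPr_optimal N S X n c A b r z' \<Longrightarrow> i < N \<Longrightarrow> z' i = z i"
  shows "card {i. i < N \<and> z i \<notin> X i} \<le> S"
proof (rule ccontr)
  define I where "I = {i. i < N \<and> z i \<notin> X i}"
  assume "\<not> card {i. i < N \<and> z i \<notin> X i} \<le> S"
  then have I: "finite I" "S < card I" "I \<subseteq> {..<N}" by (auto simp: I_def)
  have feas: "\<And>i. i < N \<Longrightarrow> z i \<in> conv (X i)"
    "\<And>s. s < S \<Longrightarrow> (\<Sum>i<N. dotp (n i) (A i s) (z i)) \<le> b s - r s"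
    using opt unfolding LPr_optimal_def LPr_feasible_def by auto
  have "\<forall>i\<in>I. \<exists>q. 0 < snd q \<and> fst q \<noteq> (\<lambda>_. 0) \<and>
      (\<forall>h. \<bar>h\<bar> \<le> snd q \<longrightarrow> (\<lambda>k. z i k + h * fst q k) \<in> conv (X i))"
  proof
    fix i assume "i \<in> I"
    then have "z i \<in> conv (X i)" "z i \<notin> X i" using feas(1) by (auto simp: I_def)
    then obtain dir e where "0 < e" "dir \<noteq> (\<lambda>_. 0)"
      "\<And>h. \<bar>h\<bar> \<le> e \<Longrightarrow> (\<lambda>k. z i k + h * dir k) \<in> conv (X i)"
      using conv_perturb by blast
    then show "\<exists>q. 0 < snd q \<and> fst q \<noteq> (\<lambda>_. 0) \<and>
        (\<forall>h. \<bar>h\<bar> \<le> snd q \<longrightarrow> (\<lambda>k. z i k + h * fst q k) \<in> conv (X i))"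
      by (intro exI[of _ "(dir, e)"]) simp
  qed
  from bchoice[OF this] obtain q where q: "\<forall>i\<in>I. 0 < snd (q i) \<and> fst (q i) \<noteq> (\<lambda>_. 0) \<and>
      (\<forall>h. \<bar>h\<bar> \<le> snd (q i) \<longrightarrow> (\<lambda>k. z i k + h * fst (q i) k) \<in> conv (X i))" ..
  define dir e where "dir i = fst (q i)" and "e i = snd (q i)" for i
  have dir: "\<And>i. i \<in> I \<Longrightarrow> 0 < e i" "\<And>i. i \<in> I \<Longrightarrow> dir i \<noteq> (\<lambda>_. 0)"
    "\<And>i h. i \<in> I \<Longrightarrow> \<bar>h\<bar> \<le> e i \<Longrightarrow> (\<lambda>k. z i k + h * dir i k) \<in> conv (X i)"
    using q by (simp_all add: dir_def e_def)
  \<comment> \<open>Moving the blocks along these multiples of their directions leaves every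
    coupling row unchanged, so feasibility persists for both signs of the step.\<close>
  obtain l where l: "\<exists>i\<in>I. l i \<noteq> 0" "\<And>s. s < S \<Longrightarrow> (\<Sum>i\<in>I. l i * dotp (n i) (A i s) (dir i)) = 0"
    using homogeneous_system_nontrivial[OF I(1,2), of "\<lambda>i s. dotp (n i) (A i s) (dir i)"] by blast
  \<comment> \<open>A step length valid for all blocks at once; the added 1 avoids division by zero
    where \<open>l i\<close> vanishes.\<close>
  define h where "h = Min ((\<lambda>i. e i / (\<bar>l i\<bar> + 1)) ` I)"
  have "I \<noteq> {}" using I by auto
  then have "0 < h" using I(1) dir(1) by (auto simp: h_def intro!: divide_pos_pos)
  have hl: "\<bar>\<tau> * l i\<bar> \<le> e i" if "i \<in> I" "\<bar>\<tau>\<bar> \<le> h" for i \<tau>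
  proof -
    have "h \<le> e i / (\<bar>l i\<bar> + 1)" using I(1) that(1) by (auto simp: h_def)
    then have "\<bar>\<tau>\<bar> * (\<bar>l i\<bar> + 1) \<le> e i" using that(2) by (simp add: pos_le_divide_eq[symmetric])
    then show ?thesis by (simp add: abs_mult algebra_simps)
  qed
  define p where "p \<tau> i = (if i \<in> I then \<lambda>k. z i k + (\<tau> * l i) * dir i k else z i)" for \<tau> i
  have sum_p: "(\<Sum>i<N. dotp (n i) (g i) (p \<tau> i)) =
      (\<Sum>i<N. dotp (n i) (g i) (z i)) + \<tau> * (\<Sum>i\<in>I. l i * dotp (n i) (g i) (dir i))" for g \<tau>
  proof -
    have "(\<Sum>i<N. dotp (n i) (g i) (p \<tau> i)) =
        (\<Sum>i<N. dotp (n i) (g i) (z i) + (if i \<in> I then \<tau> * (l i * dotp (n i) (g i) (dir i)) else 0))"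
      by (intro sum.cong) (auto simp: p_def dotp_add_scaled)
    moreover have "(\<Sum>i<N. if i \<in> I then \<tau> * (l i * dotp (n i) (g i) (dir i)) else 0) =
        (\<Sum>i\<in>I. \<tau> * (l i * dotp (n i) (g i) (dir i)))"
      using I(3) by (subst sum.inter_restrict[symmetric]) (auto simp: Int_absorb1)
    ultimately show ?thesis by (simp add: sum.distrib sum_distrib_left)
  qed
  define \<kappa> where "\<kappa> = (\<Sum>i\<in>I. l i * dotp (n i) (c i) (dir i))"
  \<comment> \<open>The sign is chosen so that the cost does not increase; the moved point is then a
    second optimum.\<close>
  define \<tau> where "\<tau> = (if \<kappa> \<le> 0 then h else - h)"
  have \<tau>: "\<bar>\<tau>\<bar> \<le> h" "\<tau> \<noteq> 0" "\<tau> * \<kappa> \<le> 0"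
    using \<open>0 < h\<close> by (auto simp: \<tau>_def mult_nonneg_nonpos)
  have "p \<tau> i \<in> conv (X i)" if "i < N" for i
    using that feas(1) dir(3) hl \<tau>(1) by (simp add: p_def)
  then have "LPr_feasible N S X n A b r (p \<tau>)"
    unfolding LPr_feasible_def using feas(2) l(2) by (simp add: sum_p)
  moreover have "(\<Sum>i<N. dotp (n i) (c i) (p \<tau> i)) \<le> (\<Sum>i<N. dotp (n i) (c i) (z i))"
    using \<tau>(3) by (simp add: sum_p flip: \<kappa>_def)
  ultimately have "LPr_optimal N S X n c A b r (p \<tau>)"
    using opt order_trans unfolding LPr_optimal_def by blast
  then have same: "p \<tau> i = z i" if "i < N" for i using unique that by blast
  obtain i where i: "i \<in> I" "l i \<noteq> 0" using l(1) by blast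
  then have "(\<lambda>k. z i k + (\<tau> * l i) * dir i k) = z i" using same[of i] I(3) by (auto simp: p_def)
  then have "dir i = (\<lambda>_. 0)" using \<tau>(2) i(2) by (simp add: fun_eq_iff)
  then show False using dir(2) i(1) by blast
qed

subsection \<open>Cost convergence of the distributed algorithm\<close>

text \<open>Raising \<open>v\<close> by 1 changes the Lagrangian by \<open>M\<close> minus the sum
  of the multipliers. Optimality makes this nonnegative.\<close>

lemma P1_multiplier_bounds:
  assumes opt: "P1_pd_opt X n S c A M y z v mu" and "s < S"
  shows "0 \<le> mu s" "mu s \<le> M"
proof -
  have mu: "\<And>s. s < S \<Longrightarrow> 0 \<le> mu s" using opt unfolding P1_pd_opt_def by blast
  have "z \<in> conv X" "0 \<le> v + 1" using opt unfolding P1_pd_opt_def by auto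
  then have "dotp n c z + M * v + (\<Sum>s<S. mu s * (dotp n (A s) z - y s - v))
      \<le> dotp n c z + M * (v + 1) + (\<Sum>s<S. mu s * (dotp n (A s) z - y s - (v + 1)))"
    using opt unfolding P1_pd_opt_def by blast
  also have "(\<Sum>s<S. mu s * (dotp n (A s) z - y s - (v + 1))) =
      (\<Sum>s<S. mu s * (dotp n (A s) z - y s - v)) - sum mu {..<S}"
    unfolding sum_subtractf[symmetric] by (intro sum.cong) (auto simp: algebra_simps)
  finally have "sum mu {..<S} \<le> M" by (simp add: algebra_simps)
  moreover have "mu s \<le> sum mu {..<S}" using \<open>s < S\<close> mu by (intro member_le_sum) auto
  ultimately show "mu s \<le> M" by simp
  show "0 \<le> mu s" using mu \<open>s < S\<close> .
qed

text \<open>The multipliers are negative subgradients of the optimal value as a function of the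
  allocation.\<close>

lemma P1_subgradient:
  assumes opt: "P1_pd_opt X n S c A M y z v mu"
    and "z' \<in> conv X" "0 \<le> v'" and feas: "\<And>s. s < S \<Longrightarrow> dotp n (A s) z' \<le> y' s + v'"
  shows "dotp n c z + M * v \<le> dotp n c z' + M * v' + (\<Sum>s<S. mu s * (y' s - y s))"
proof -
  have "(\<Sum>s<S. mu s * (dotp n (A s) z - y s - v)) = 0" using opt unfolding P1_pd_opt_def by blast
  moreover have "dotp n c z + M * v + (\<Sum>s<S. mu s * (dotp n (A s) z - y s - v))
      \<le> dotp n c z' + M * v' + (\<Sum>s<S. mu s * (dotp n (A s) z' - y s - v'))"
    using opt assms(2,3) unfolding P1_pd_opt_def by blast
  moreover have "(\<Sum>s<S. mu s * (dotp n (A s) z' - y s - v')) \<le> (\<Sum>s<S. mu s * (y' s - y s))"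
    using feas P1_multiplier_bounds(1)[OF opt] by (intro sum_mono mult_left_mono) (auto simp: algebra_simps)
  ultimately show ?thesis by linarith
qed

section \<open>Invariants and costs along one run of the algorithm\<close>

context
  fixes N S :: nat and X :: "nat \<Rightarrow> (nat \<Rightarrow> real) set" and n :: "nat \<Rightarrow> nat"
    and c :: "nat \<Rightarrow> nat \<Rightarrow> real" and A :: "nat \<Rightarrow> nat \<Rightarrow> nat \<Rightarrow> real"
    and Nb :: "nat \<Rightarrow> nat set" and alpha :: "nat \<Rightarrow> real" and M :: real
    and y z mu x :: "nat \<Rightarrow> nat \<Rightarrow> nat \<Rightarrow> real" and v :: "nat \<Rightarrow> nat \<Rightarrow> real"
    and \<beta> :: "nat \<Rightarrow> real"
  assumes run: "alg_run N S X n c A Nb alpha M y z v mu x"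
    and graph: "connected_undirected N Nb"
    and init: "\<And>s. s < S \<Longrightarrow> (\<Sum>i<N. y 0 i s) = \<beta> s"
begin

lemma run_P1: "i < N \<Longrightarrow> P1_pd_opt (X i) (n i) S (c i) (A i) M (y t i) (z t i) (v t i) (mu t i)"
  and run_step: "i < N \<Longrightarrow> s < S \<Longrightarrow>
    y (Suc t) i s = y t i s + alpha t * (\<Sum>j\<in>Nb i. mu t i s - mu t j s)"
  using run unfolding alg_run_def by blast+

lemma run_primal:
  "i < N \<Longrightarrow> z t i \<in> conv (X i)" "i < N \<Longrightarrow> 0 \<le> v t i"
  "i < N \<Longrightarrow> s < S \<Longrightarrow> dotp (n i) (A i s) (z t i) \<le> y t i s + v t i"
  using run_P1[of i t] unfolding P1_pd_opt_def by blast+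

text \<open>The exchanges over an edge are opposite at its two ends, so the total allocation is
  conserved.\<close>

lemma allocation_sum: "s < S \<Longrightarrow> (\<Sum>i<N. y t i s) = \<beta> s"
proof (induction t)
  case (Suc t)
  have "(\<Sum>i<N. \<Sum>j\<in>Nb i. mu t i s - mu t j s) = 0"
    using neighbour_sum_swap[OF graph, of "\<lambda>i j. mu t i s - mu t j s"]
    by (simp add: sum_subtractf)
  then show ?case
    using Suc by (simp add: run_step sum.distrib flip: sum_distrib_left)
qed (rule init)

lemma run_aggregate:
  "s < S \<Longrightarrow> (\<Sum>i<N. dotp (n i) (A i s) (z t i)) \<le> \<beta> s + (\<Sum>i<N. v t i)"
  using sum_mono[of "{..<N}" "\<lambda>i. dotp (n i) (A i s) (z t i)" "\<lambda>i. y t i s + v t i"] run_primal(3)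
  by (simp add: sum.distrib allocation_sum)

lemma multiplier_diff_bound:
  assumes "i < N" "j \<in> Nb i" "s < S"
  shows "\<bar>mu t i s - mu t j s\<bar> \<le> M"
proof -
  have "j < N" using connected_undirectedD(1)[OF graph] assms by blast
  with assms(1,3) show ?thesis
    using P1_multiplier_bounds[OF run_P1[of i t]] P1_multiplier_bounds[OF run_P1[of j t]]
    by (smt (verit))
qed

lemma neighbour_sum_le:
  assumes "i < N" "\<And>j. j \<in> Nb i \<Longrightarrow> f j \<le> C" "0 \<le> (C :: real)"
  shows "(\<Sum>j\<in>Nb i. f j) \<le> real N * C"
proof -
  have "Nb i \<subseteq> {..<N}" using connected_undirectedD(1)[OF graph assms(1)] by auto
  then have "card (Nb i) \<le> N" using card_mono[of "{..<N}" "Nb i"] by simp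
  then have "real (card (Nb i)) * C \<le> real N * C" using assms(3) by (intro mult_right_mono) auto
  then show ?thesis using sum_bounded_above[of "Nb i" f C] assms(2) by fastforce
qed

definition cost :: "nat \<Rightarrow> real" where
  "cost t = (\<Sum>i<N. dotp (n i) (c i) (z t i) + M * v t i)"

lemma cost_subgradient:
  assumes "\<And>i. i < N \<Longrightarrow> z' i \<in> conv (X i)" "\<And>i. i < N \<Longrightarrow> 0 \<le> v' i"
    "\<And>i s. i < N \<Longrightarrow> s < S \<Longrightarrow> dotp (n i) (A i s) (z' i) \<le> y' i s + v' i"
  shows "cost t \<le> (\<Sum>i<N. dotp (n i) (c i) (z' i) + M * v' i)
    + (\<Sum>s<S. \<Sum>i<N. mu t i s * (y' i s - y t i s))"
proof -
  have "cost t \<le> (\<Sum>i<N. dotp (n i) (c i) (z' i) + M * v' i + (\<Sum>s<S. mu t i s * (y' i s - y t i s)))"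
    unfolding cost_def using assms by (intro sum_mono P1_subgradient[OF run_P1]) auto
  then show ?thesis by (simp add: sum.distrib sum.swap[of _ "{..<S}"])
qed

text \<open>The solutions of time \<open>t\<close> serve as trial points in the subgradient
  inequality of time \<open>t + 1\<close>. Multipliers are at most \<open>M\<close>, and no
  allocation entry drops by more than \<open>alpha t * (real N * M)\<close>.\<close>

lemma cost_step:
  assumes "0 \<le> M" "0 \<le> alpha t"
  shows "cost (Suc t) \<le> cost t + (real S * (real N * (M * (real N * M)))) * alpha t"
proof -
  have "cost (Suc t) \<le> cost t + (\<Sum>s<S. \<Sum>i<N. mu (Suc t) i s * (y t i s - y (Suc t) i s))"
    unfolding cost_def[of t] by (intro cost_subgradient run_primal)
  also have "(\<Sum>s<S. \<Sum>i<N. mu (Suc t) i s * (y t i s - y (Suc t) i s)) \<le>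
      (\<Sum>s<S. \<Sum>i<N. M * (alpha t * (real N * M)))"
  proof (intro sum_mono)
    fix s i assume si: "s \<in> {..<S}" "i \<in> {..<N}"
    have "y t i s - y (Suc t) i s = alpha t * (\<Sum>j\<in>Nb i. mu t j s - mu t i s)"
      using si by (simp add: run_step right_diff_distrib sum_subtractf)
    also have "\<dots> \<le> alpha t * (real N * M)"
      using si assms multiplier_diff_bound[of i _ s t]
      by (intro mult_left_mono neighbour_sum_le) (auto simp: abs_le_iff)
    finally have 1: "y t i s - y (Suc t) i s \<le> alpha t * (real N * M)" .
    have mu: "0 \<le> mu (Suc t) i s" "mu (Suc t) i s \<le> M"
      using P1_multiplier_bounds[OF run_P1] si by auto
    have "mu (Suc t) i s * (y t i s - y (Suc t) i s) \<le> mu (Suc t) i s * (alpha t * (real N * M))"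
      using 1 mu by (intro mult_left_mono) auto
    also have "\<dots> \<le> M * (alpha t * (real N * M))"
      using mu assms by (intro mult_right_mono) auto
    finally show "mu (Suc t) i s * (y t i s - y (Suc t) i s) \<le> M * (alpha t * (real N * M))" .
  qed
  finally show ?thesis by (simp add: algebra_simps)
qed

text \<open>The Lyapunov function is the squared distance, edge by edge, between the accumulated
  exchanges and a flow that carries the initial allocation to the optimal one.\<close>

lemma cost_gap_summable:
  assumes M: "0 \<le> M" and alpha: "\<And>t. 0 \<le> alpha t" "summable (\<lambda>t. (alpha t)\<^sup>2)"
    and sum_y': "\<And>s. s < S \<Longrightarrow> (\<Sum>i<N. y' i s) = \<beta> s"
    and gap: "\<And>t. C \<le> cost t"
    and sub: "\<And>t. cost t \<le> C + (\<Sum>s<S. \<Sum>i<N. mu t i s * (y' i s - y t i s))"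
  shows "summable (\<lambda>t. alpha t * (cost t - C))"
proof -
  have "\<forall>s. \<exists>f. s < S \<longrightarrow> (\<forall>i j. f j i = - f i j) \<and> (\<forall>i<N. (\<Sum>j\<in>Nb i. f i j) = y' i s - y 0 i s)"
    using flow_with_divergence[OF graph] sum_y' init by (simp add: sum_subtractf)
  then obtain f where f: "\<And>s i j. s < S \<Longrightarrow> f s j i = - f s i j"
    "\<And>s i. s < S \<Longrightarrow> i < N \<Longrightarrow> (\<Sum>j\<in>Nb i. f s i j) = y' i s - y 0 i s" by metis
  \<comment> \<open>The edgewise error. Its divergence at agent \<open>i\<close> is the distance of
    the current allocation from \<open>y'\<close>, which links it to the subgradient
    inequality.\<close>
  define E where "E t s i j = (\<Sum>\<tau><t. alpha \<tau> * (mu \<tau> i s - mu \<tau> j s)) - f s i j" for t s i j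
  have E_anti: "E t s j i = - E t s i j" if "s < S" for t s i j
  proof -
    have "(\<Sum>\<tau><t. alpha \<tau> * (mu \<tau> j s - mu \<tau> i s)) = - (\<Sum>\<tau><t. alpha \<tau> * (mu \<tau> i s - mu \<tau> j s))"
      unfolding sum_negf[symmetric] by (intro sum.cong) (auto simp: algebra_simps)
    then show ?thesis unfolding E_def using f(1)[OF that, of i j] by simp
  qed
  have E_Suc: "E (Suc t) s i j = E t s i j + alpha t * (mu t i s - mu t j s)" for t s i j
    by (simp add: E_def)
  have E_div: "(\<Sum>j\<in>Nb i. E t s i j) = y t i s - y' i s" if "s < S" "i < N" for t s i
  proof (induction t)
    case 0 show ?case using f(2) that by (simp add: E_def sum_negf)
  next
    case (Suc t)
    then show ?case using that by (simp add: E_Suc run_step sum.distrib sum_distrib_left)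
  qed
  define V where "V t = (\<Sum>s<S. \<Sum>i<N. \<Sum>j\<in>Nb i. (E t s i j)\<^sup>2)" for t
  define K where "K = real S * (real N * (real N * M\<^sup>2))"
  have V_nonneg: "0 \<le> V t" for t unfolding V_def by (intro sum_nonneg) auto
  \<comment> \<open>One factor 2 of the 4 comes from expanding the square, the other from counting
    each edge twice.\<close>
  have V_Suc: "4 * (alpha t * (cost t - C)) \<le> V t - V (Suc t) + K * (alpha t)\<^sup>2" for t
  proof -
    have "V (Suc t) = V t + 2 * alpha t * (\<Sum>s<S. \<Sum>i<N. \<Sum>j\<in>Nb i. (mu t i s - mu t j s) * E t s i j)
        + (alpha t)\<^sup>2 * (\<Sum>s<S. \<Sum>i<N. \<Sum>j\<in>Nb i. (mu t i s - mu t j s)\<^sup>2)"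
      unfolding V_def E_Suc sum_distrib_left sum.distrib[symmetric]
      by (intro sum.cong refl) (simp add: power2_eq_square algebra_simps)
    moreover have "(\<Sum>s<S. \<Sum>i<N. \<Sum>j\<in>Nb i. (mu t i s - mu t j s) * E t s i j) =
        (\<Sum>s<S. 2 * (\<Sum>i<N. mu t i s * (y t i s - y' i s)))"
    proof (intro sum.cong refl)
      fix s assume "s \<in> {..<S}"
      then have s: "s < S" by simp
      show "(\<Sum>i<N. \<Sum>j\<in>Nb i. (mu t i s - mu t j s) * E t s i j) =
          2 * (\<Sum>i<N. mu t i s * (y t i s - y' i s))"
        using neighbour_sum_antisym[OF graph, of "E t s" "\<lambda>i. mu t i s", OF E_anti[OF s]] E_div[OF s]
        by simp
    qed
    moreover have "(\<Sum>s<S. \<Sum>i<N. mu t i s * (y t i s - y' i s)) \<le> C - cost t"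
      using sub[of t] by (simp add: right_diff_distrib sum_subtractf)
    moreover have "(\<Sum>s<S. \<Sum>i<N. \<Sum>j\<in>Nb i. (mu t i s - mu t j s)\<^sup>2) \<le> K"
    proof -
      have "(\<Sum>s<S. \<Sum>i<N. \<Sum>j\<in>Nb i. (mu t i s - mu t j s)\<^sup>2) \<le> (\<Sum>s<S. \<Sum>i<N. real N * M\<^sup>2)"
        using multiplier_diff_bound M
        by (intro sum_mono neighbour_sum_le) (auto simp: abs_le_square_iff[symmetric])
      then show ?thesis by (simp add: K_def)
    qed
    moreover have "V (Suc t) \<le> V t + 2 * alpha t * (2 * (C - cost t)) + (alpha t)\<^sup>2 * K"
      if "V (Suc t) = V t + 2 * alpha t * P + (alpha t)\<^sup>2 * G" "P = 2 * Q" "Q \<le> C - cost t" "G \<le> K"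
      for P Q G
    proof -
      have "2 * alpha t * P \<le> 2 * alpha t * (2 * (C - cost t))"
        using that alpha(1)[of t] by (intro mult_left_mono) auto
      moreover have "(alpha t)\<^sup>2 * G \<le> (alpha t)\<^sup>2 * K" using that by (intro mult_left_mono) auto
      ultimately show ?thesis using that(1) by linarith
    qed
    ultimately have "V (Suc t) \<le> V t + 2 * alpha t * (2 * (C - cost t)) + (alpha t)\<^sup>2 * K"
      unfolding sum_distrib_left[symmetric] by blast
    then show ?thesis by (simp add: algebra_simps)
  qed
  \<comment> \<open>Telescoping over \<open>V\<close>, which is nonnegative, bounds all partial
    sums.\<close>
  have "(\<Sum>t<T. alpha t * (cost t - C)) \<le> (V 0 + K * (\<Sum>t. (alpha t)\<^sup>2)) / 4" for T
  proof -
    have "(\<Sum>t<T. 4 * (alpha t * (cost t - C))) \<le> (\<Sum>t<T. V t - V (Suc t) + K * (alpha t)\<^sup>2)"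
      using V_Suc by (rule sum_mono)
    also have "\<dots> = V 0 - V T + K * (\<Sum>t<T. (alpha t)\<^sup>2)"
      by (simp add: sum.distrib sum_distrib_left sum_lessThan_telescope')
    also have "\<dots> \<le> V 0 + K * (\<Sum>t. (alpha t)\<^sup>2)"
    proof -
      have "(\<Sum>t<T. (alpha t)\<^sup>2) \<le> (\<Sum>t. (alpha t)\<^sup>2)"
        by (intro sum_le_suminf alpha(2)) auto
      then have "K * (\<Sum>t<T. (alpha t)\<^sup>2) \<le> K * (\<Sum>t. (alpha t)\<^sup>2)"
        by (intro mult_left_mono) (simp_all add: K_def)
      then show ?thesis using V_nonneg[of T] by linarith
    qed
    finally show ?thesis by (simp flip: sum_distrib_left)
  qed
  then show ?thesis
    using alpha(1) gap by (intro summableI_nonneg_bounded mult_nonneg_nonneg) (simp_all only: diff_ge_0_iff_ge)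
qed

text \<open>A central solution with one scalar relaxation \<open>wh\<close> is turned into local
  solutions with an allocation of the right total, so that the summability of the gaps applies to
  it.\<close>

lemma cost_tendsto:
  assumes M: "0 \<le> M" and N: "0 < N" and alpha: "\<And>t. 0 \<le> alpha t" "summable (\<lambda>t. (alpha t)\<^sup>2)"
      "filterlim (\<lambda>T. \<Sum>t<T. alpha t) at_top sequentially"
    and zh: "\<And>i. i < N \<Longrightarrow> zh i \<in> conv (X i)" and wh: "0 \<le> wh"
    and feas: "\<And>s. s < S \<Longrightarrow> (\<Sum>i<N. dotp (n i) (A i s) (zh i)) \<le> \<beta> s + wh"
    and gap: "\<And>t. (\<Sum>i<N. dotp (n i) (c i) (zh i)) + M * wh \<le> cost t"
  shows "cost \<longlonglongrightarrow> (\<Sum>i<N. dotp (n i) (c i) (zh i)) + M * wh"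
proof -
  define C where "C = (\<Sum>i<N. dotp (n i) (c i) (zh i)) + M * wh"
  define sl where "sl s = \<beta> s + wh - (\<Sum>i<N. dotp (n i) (A i s) (zh i))" for s
  \<comment> \<open>Each agent receives its own usage, minus an equal share of the relaxation, plus
    an equal share of the slack. The totals are then exactly \<open>\<beta>\<close>, and each local
    violation \<open>wh / N\<close> is admissible.\<close>
  define y' where "y' i s = dotp (n i) (A i s) (zh i) - wh / N + sl s / N" for i s
  have sum_y': "(\<Sum>i<N. y' i s) = \<beta> s" for s
    using N by (simp add: y'_def sum.distrib sum_subtractf) (simp add: sl_def)
  have sub: "cost t \<le> C + (\<Sum>s<S. \<Sum>i<N. mu t i s * (y' i s - y t i s))" for t
  proof -
    have "cost t \<le> (\<Sum>i<N. dotp (n i) (c i) (zh i) + M * (wh / N))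
        + (\<Sum>s<S. \<Sum>i<N. mu t i s * (y' i s - y t i s))"
      using zh wh feas by (intro cost_subgradient) (auto simp: y'_def sl_def)
    also have "(\<Sum>i<N. dotp (n i) (c i) (zh i) + M * (wh / N)) = C"
      using N by (simp add: C_def sum.distrib)
    finally show ?thesis .
  qed
  have gapC: "C \<le> cost t" for t using gap by (simp add: C_def)
  have summ: "summable (\<lambda>t. alpha t * (cost t - C))"
    by (rule cost_gap_summable[OF M alpha(1,2) sum_y' gapC sub])
  have "(\<lambda>t. cost t - C) \<longlonglongrightarrow> 0"
    \<comment> \<open>The constant \<open>B\<close> is the one from
      \<open>cost_step\<close>.\<close>
    by (rule tendsto_zero_of_summable_weighted[OF _ alpha(1,3,2) summ, where
          B = "real S * (real N * (M * (real N * M)))"])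
      (use gapC cost_step[OF M alpha(1)] M in \<open>auto simp: algebra_simps\<close>)
  from tendsto_add[OF this tendsto_const[of C]] show ?thesis by (simp add: C_def)
qed

end

subsection \<open>Finite-time feasibility\<close>

text \<open>Tychonoff's theorem, transferred from abstract product topologies to the function
  type.\<close>

lemma compact_PiE_UNIV:
  fixes K :: "'i \<Rightarrow> 'a::topological_space set"
  assumes "\<And>i. compact (K i)"
  shows "compact (PiE UNIV K)"
  using assms by (simp add: compactin_PiE flip: compactin_euclidean_iff euclidean_product_topology)

lemma continuous_on_Max_insert:
  fixes g :: "'i \<Rightarrow> 'a::topological_space \<Rightarrow> real"
  assumes "finite I" "\<And>i. i \<in> I \<Longrightarrow> continuous_on T (g i)"
  shows "continuous_on T (\<lambda>x. Max (insert a ((\<lambda>i. g i x) ` I)))"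
  using assms
proof (induction I rule: finite_induct)
  case (insert i I)
  have "Max (insert a ((\<lambda>i. g i x) ` insert i I)) = max (g i x) (Max (insert a ((\<lambda>i. g i x) ` I)))" for x
    using insert(1) by (simp add: insert_commute[of a])
  then show ?case using insert by (simp add: continuous_on_max)
qed simp

text \<open>Any \<open>x'\<close> that is admissible at level \<open>\<rho>\<close> bounds the
  minimal level of the first stage, which \<open>x\<close> attains.\<close>

lemma P3_lexmin_rounding:
  assumes "P3_lexmin X n S c A y x" and "x' \<in> X" "0 \<le> \<rho>"
    and "\<And>s. s < S \<Longrightarrow> dotp n (A s) x' \<le> y s + \<rho>"
  shows "x \<in> X" "\<And>s. s < S \<Longrightarrow> dotp n (A s) x \<le> y s + \<rho>"
proof -
  obtain rho where rho: "x \<in> X" "\<forall>s<S. dotp n (A s) x \<le> y s + rho"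
    "\<forall>x'\<in>X. \<forall>rho'\<ge>0. (\<forall>s<S. dotp n (A s) x' \<le> y s + rho') \<longrightarrow> rho \<le> rho'"
    using assms(1) unfolding P3_lexmin_def by blast
  then have "rho \<le> \<rho>" using assms(2-4) by blast
  then show "x \<in> X" "\<And>s. s < S \<Longrightarrow> dotp n (A s) x \<le> y s + \<rho>" using rho by force+
qed

theorem theorem3:
  fixes N S :: nat
    and Z R m :: "nat \<Rightarrow> nat"
    and c :: "nat \<Rightarrow> nat \<Rightarrow> real"
    and A :: "nat \<Rightarrow> nat \<Rightarrow> nat \<Rightarrow> real"
    and D :: "nat \<Rightarrow> nat \<Rightarrow> nat \<Rightarrow> real"
    and d :: "nat \<Rightarrow> nat \<Rightarrow> real"
    and b :: "nat \<Rightarrow> real"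
    and xL :: "nat \<Rightarrow> nat \<Rightarrow> real"
    and lt :: "nat \<Rightarrow> real"
    and \<delta> :: real
  defines "n \<equiv> (\<lambda>i. Z i + R i)"
    and "X \<equiv> (\<lambda>i. MIset (Z i) (R i) (m i) (D i) (d i))"
  assumes dims: "0 < N" "0 < S"
    and nonempty: "\<forall>i<N. X i \<noteq> {}"
    and compact: "\<forall>i<N. compact (X i)"
    and milp_feasible: "\<exists>x. MILP_feasible N S X n A b x"
    and xL_opt: "\<forall>i<N. Lopt (X i) (n i) S (A i) (xL i) (lt i)"
    and delta_pos: "\<delta> > 0"
    and assumptionA: "LPr_unique_opt N S X n c A b (\<lambda>s. sigmaASY N S X n A xL + \<delta>)"
  shows "\<exists>M0. \<forall>M>M0. \<forall>(Nb :: nat \<Rightarrow> nat set) (alpha :: nat \<Rightarrow> real) y z v mu x.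
           connected_undirected N Nb \<longrightarrow>
           (\<forall>t. 0 \<le> alpha t) \<longrightarrow>
           filterlim (\<lambda>T. \<Sum>t<T. alpha t) at_top sequentially \<longrightarrow>
           summable (\<lambda>t. (alpha t)\<^sup>2) \<longrightarrow>
           (\<forall>s<S. (\<Sum>i<N. y 0 i s) = b s - (sigmaASY N S X n A xL + \<delta>)) \<longrightarrow>
           alg_run N S X n c A Nb alpha M y z v mu x \<longrightarrow>
           (\<exists>T>0. \<forall>t\<ge>T. MILP_feasible N S X n A b (x t))"
proof -

  \<comment> \<open>Compactness of the data and the rounding loss \<open>\<Delta>\<close>\<close>
  have supp: "x k = 0" if "x \<in> X i" "n i \<le> k" for x i k
    using that unfolding X_def n_def MIset_def by blast
  have cpt_conv: "compact (conv (X i))" if "i < N" for i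
    using compact that supp by (intro compact_conv[of "X i" "n i"]) auto
  define \<Delta> where
    "\<Delta> = (MAX i\<in>{0..<N}. MAX s\<in>{0..<S}. dotp (n i) (A i s) (xL i) - Lmin (X i) (n i) (A i s))"
  have sigma: "sigmaASY N S X n A xL = real (S + 1) * \<Delta>"
    by (simp add: sigmaASY_def \<Delta>_def)
  have Lmin: "Lmin (X i) (n i) (A i s) \<le> dotp (n i) (A i s) x" if "i < N" "x \<in> X i" for i s x
  proof -
    have "compact ((\<lambda>x. dotp (n i) (A i s) x) ` X i)"
      using compact that(1) by (intro compact_continuous_image continuous_on_dotp continuous_on_id) auto
    then have "bdd_below ((\<lambda>x. dotp (n i) (A i s) x) ` X i)"
      by (intro bounded_imp_bdd_below compact_imp_bounded)
    then show ?thesis unfolding Lmin_def using that(2) by (rule cINF_lower)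
  qed
  have xL: "xL i \<in> X i" if "i < N" for i
    using xL_opt that unfolding Lopt_def by blast
  have \<Delta>: "dotp (n i) (A i s) (xL i) - Lmin (X i) (n i) (A i s) \<le> \<Delta>" if "i < N" "s < S" for i s
  proof -
    have "dotp (n i) (A i s) (xL i) - Lmin (X i) (n i) (A i s) \<le>
        (MAX s\<in>{0..<S}. dotp (n i) (A i s) (xL i) - Lmin (X i) (n i) (A i s))"
      using that by (intro Max_ge) auto
    also have "\<dots> \<le> \<Delta>" unfolding \<Delta>_def using that by (intro Max_ge) auto
    finally show ?thesis .
  qed
  have \<Delta>_nonneg: "0 \<le> \<Delta>"
    using \<Delta>[of 0 0] Lmin[of 0 "xL 0" 0] xL[of 0] dims by linarith

  \<comment> \<open>The restricted optimum, the penalised problem and the threshold for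
    \<open>M\<close>\<close>
  define \<sigma> where "\<sigma> = sigmaASY N S X n A xL + \<delta>"
  define \<beta> where "\<beta> s = b s - \<sigma>" for s
  obtain zs where zs: "LPr_optimal N S X n c A b (\<lambda>s. \<sigma>) zs"
    and unique: "\<And>z' i. LPr_optimal N S X n c A b (\<lambda>s. \<sigma>) z' \<Longrightarrow> i < N \<Longrightarrow> z' i = zs i"
    using assumptionA unfolding LPr_unique_opt_def \<sigma>_def by blast
  have frac: "card {i. i < N \<and> zs i \<notin> X i} \<le> S"
    using card_fractional_blocks_le[OF zs] unique by blast

  define F where "F z = (\<Sum>i<N. dotp (n i) (c i) (z i))" for z
  define g where "g s z = (\<Sum>i<N. dotp (n i) (A i s) (z i)) - \<beta> s" for s z
  \<comment> \<open>The least scalar relaxation that makes \<open>z\<close> admissible; it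
    eliminates the extra variable of the penalised problem.\<close>
  define viol where "viol z = Max (insert 0 ((\<lambda>s. g s z) ` {..<S}))" for z
  have dotp_cont: "continuous_on UNIV (\<lambda>z :: nat \<Rightarrow> nat \<Rightarrow> real. dotp k a (z i))" for k a i
    by (intro continuous_on_dotp continuous_on_product_coordinates)
  have F_cont: "continuous_on UNIV F"
    unfolding F_def by (intro continuous_on_sum dotp_cont)
  have viol_cont: "continuous_on UNIV viol"
    unfolding viol_def g_def
    by (intro continuous_on_Max_insert continuous_on_diff continuous_on_sum continuous_on_const dotp_cont) auto
  have viol_nonneg: "0 \<le> viol z" for z by (simp add: viol_def)
  have viol_ge: "g s z \<le> viol z" if "s < S" for s z using that by (simp add: viol_def)
  have viol_le: "viol z \<le> w" if "0 \<le> w" "\<And>s. s < S \<Longrightarrow> g s z \<le> w" for z w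
    using that by (auto simp: viol_def)

  \<comment> \<open>Blocks beyond \<open>N\<close> are pinned to zero, so that the product over all
    indices is compact; \<open>tr\<close> carries arbitrary block families to this form.\<close>
  define K where "K = PiE UNIV (\<lambda>i. if i < N then conv (X i) else {\<lambda>_. 0})"
  define tr :: "(nat \<Rightarrow> nat \<Rightarrow> real) \<Rightarrow> nat \<Rightarrow> nat \<Rightarrow> real"
    where "tr z i = (if i < N then z i else (\<lambda>_. 0))" for z i
  have K_cpt: "compact K"
    unfolding K_def using cpt_conv by (intro compact_PiE_UNIV) auto
  have tr: "F (tr z) = F z" "g s (tr z) = g s z" "viol (tr z) = viol z" for z s
    by (simp_all add: F_def g_def viol_def tr_def)
  have trK: "tr z \<in> K" if "\<And>i. i < N \<Longrightarrow> z i \<in> conv (X i)" for z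
    using that by (auto simp: K_def tr_def)
  have K_conv: "z i \<in> conv (X i)" if "z \<in> K" "i < N" for z i
  proof -
    have "z i \<in> (if i < N then conv (X i) else {\<lambda>_. 0})" using that(1) unfolding K_def by blast
    then show ?thesis using that(2) by simp
  qed
  have LPr: "LPr_feasible N S X n A b (\<lambda>s. \<sigma>) z \<longleftrightarrow> (\<forall>i<N. z i \<in> conv (X i)) \<and> viol z = 0" for z
  proof -
    have "(\<forall>s<S. g s z \<le> 0) \<longleftrightarrow> viol z = 0"
      using viol_ge viol_le[of 0 z] viol_nonneg[of z] by (metis order_antisym order_refl)
    then show ?thesis unfolding LPr_feasible_def g_def \<beta>_def by simp
  qed
  have zs_conv: "\<And>i. i < N \<Longrightarrow> zs i \<in> conv (X i)" and zs_viol: "viol zs = 0"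
    using zs LPr unfolding LPr_optimal_def by auto

  \<comment> \<open>The budget \<open>\<delta>\<close> is split into one \<open>\<epsilon>\<close>
    per agent for the distance to \<open>zs\<close> and one more for the total of the local
    violations.\<close>
  define \<epsilon> where "\<epsilon> = \<delta> / (real N + 1)"
  have \<epsilon>: "0 < \<epsilon>" "real N * \<epsilon> + \<epsilon> = \<delta>"
  proof -
    show "0 < \<epsilon>" using delta_pos by (simp add: \<epsilon>_def)
    have "(real N + 1) * \<epsilon> = \<delta>" by (simp add: \<epsilon>_def)
    then show "real N * \<epsilon> + \<epsilon> = \<delta>" by (simp add: distrib_right)
  qed
  \<comment> \<open>A one-sided neighbourhood: \<open>zs\<close> may use at most
    \<open>\<epsilon>\<close> more than \<open>z\<close>, which is the direction in which
    \<open>zs i\<close> certifies a bound in (P3).\<close>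
  define U where "U = (\<Inter>i\<in>{..<N}. \<Inter>s\<in>{..<S}.
      {z. dotp (n i) (A i s) (zs i) < dotp (n i) (A i s) (z i) + \<epsilon>})"
  have "open U"
    unfolding U_def
    by (intro open_INT finite_lessThan ballI open_Collect_less continuous_on_const continuous_on_add dotp_cont)
  have "z \<in> U" if z: "z \<in> K" "viol z = 0" "F z \<le> F zs" for z
  proof -
    have "LPr_feasible N S X n A b (\<lambda>s. \<sigma>) z" using LPr z K_conv by blast
    then have "LPr_optimal N S X n c A b (\<lambda>s. \<sigma>) z"
      using zs z(3) order_trans unfolding LPr_optimal_def F_def by blast
    then have "z i = zs i" if "i < N" for i using unique that by blast
    then show ?thesis using \<epsilon> by (simp add: U_def)
  qed
  then obtain M1 \<eta> where M1: "0 < M1" and \<eta>: "0 < \<eta>" "\<eta> \<le> 1"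
    and loc: "\<And>M z. M1 \<le> M \<Longrightarrow> z \<in> K \<Longrightarrow> F z + M * viol z < F zs + \<eta> \<Longrightarrow> z \<in> U"
    using penalty_localization[OF K_cpt F_cont viol_cont viol_nonneg \<open>open U\<close>, of "F zs"] by metis
  have K_ne: "K \<noteq> {}" using trK[OF zs_conv] by blast
  obtain z0 where z0: "\<And>z. z \<in> K \<Longrightarrow> F z0 \<le> F z"
    using continuous_attains_inf[OF K_cpt K_ne continuous_on_subset[OF F_cont]] by blast
  \<comment> \<open>The first term forces near-optimal points into \<open>U\<close>; the second
    forces their violation below \<open>\<epsilon>\<close>. Both depend on the problem data only,
    not on the graph or the run.\<close>
  define M0 where "M0 = max M1 ((F zs + 1 - F z0) / \<epsilon>)"

  \<comment> \<open>A run with \<open>M\<close> above the threshold\<close>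
  have eventually_feasible: "\<exists>T>0. \<forall>t\<ge>T. MILP_feasible N S X n A b (x t)"
    if "M0 < M" and graph: "connected_undirected N Nb" and alpha: "\<forall>t. 0 \<le> alpha t"
      and diverges: "filterlim (\<lambda>T. \<Sum>t<T. alpha t) at_top sequentially"
      and sq: "summable (\<lambda>t. (alpha t)\<^sup>2)"
      and init: "\<forall>s<S. (\<Sum>i<N. y 0 i s) = b s - (sigmaASY N S X n A xL + \<delta>)"
      and run: "alg_run N S X n c A Nb alpha M y z v mu x"
    for M Nb and alpha :: "nat \<Rightarrow> real" and y z v mu x
  proof -
    have M: "M1 \<le> M" "0 \<le> M" "(F zs + 1 - F z0) / \<epsilon> < M" using \<open>M0 < M\<close> M1 by (auto simp: M0_def)
    have init': "(\<Sum>i<N. y 0 i s) = \<beta> s" if "s < S" for s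
      using init that by (simp add: \<beta>_def \<sigma>_def)
    have primal: "\<And>t i. i < N \<Longrightarrow> z t i \<in> conv (X i)" "\<And>t i. i < N \<Longrightarrow> 0 \<le> v t i"
      "\<And>t i s. i < N \<Longrightarrow> s < S \<Longrightarrow> dotp (n i) (A i s) (z t i) \<le> y t i s + v t i"
      using run_primal[OF run graph init'] by blast+
    define cst where "cst t = F (z t) + M * (\<Sum>i<N. v t i)" for t
    have cst: "cost N n c M z v = cst"
      by (rule ext) (simp add: cost_def[OF run graph init'] cst_def F_def sum.distrib sum_distrib_left)
    have v_sum: "0 \<le> (\<Sum>i<N. v t i)" for t using primal(2) by (intro sum_nonneg) auto
    have zK: "tr (z t) \<in> K" for t using trK primal(1) by blast
    \<comment> \<open>The local violations add up to an admissible central relaxation, so the cost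
      dominates the penalised objective.\<close>
    have viol_z: "viol (z t) \<le> (\<Sum>i<N. v t i)" for t
      using v_sum run_aggregate[OF run graph init'] by (intro viol_le) (auto simp: g_def algebra_simps)
    then have cst_ge: "F (z t) + M * viol (z t) \<le> cst t" for t
      using M by (simp add: cst_def mult_left_mono)
    have "continuous_on K (\<lambda>z. F z + M * viol z)"
      using F_cont viol_cont by (intro continuous_intros) (auto intro: continuous_on_subset)
    then obtain zh where zh: "zh \<in> K" "\<And>z. z \<in> K \<Longrightarrow> F zh + M * viol zh \<le> F z + M * viol z"
      using continuous_attains_inf[OF K_cpt K_ne] by blast
    have "cst \<longlonglongrightarrow> F zh + M * viol zh"
      unfolding F_def cst[symmetric]
    proof (rule cost_tendsto[OF run graph init'])
      show "(\<Sum>i<N. dotp (n i) (c i) (zh i)) + M * viol zh \<le> cost N n c M z v t" for t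
        using zh(2)[OF zK[of t]] cst_ge[of t] unfolding cst tr by (simp add: F_def)
      show "(\<Sum>i<N. dotp (n i) (A i s) (zh i)) \<le> \<beta> s + viol zh" if "s < S" for s
        using viol_ge[OF that, of zh] by (simp add: g_def)
    qed (use M dims alpha sq diverges K_conv zh(1) viol_nonneg in auto)
    \<comment> \<open>The point \<open>zs\<close> has no violation, so the penalised optimum, which
      is the limit of the costs, is at most \<open>F zs\<close>.\<close>
    moreover have "F zh + M * viol zh < F zs + \<eta>"
      using zh(2)[OF trK[OF zs_conv]] zs_viol \<eta> by (simp add: tr)
    ultimately have "eventually (\<lambda>t. cst t < F zs + \<eta>) sequentially" by (rule order_tendstoD(2))
    then obtain T where T: "\<And>t. T \<le> t \<Longrightarrow> cst t < F zs + \<eta>"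
      unfolding eventually_sequentially by blast
    \<comment> \<open>\<open>Suc T\<close> makes the final time positive.\<close>
    have "MILP_feasible N S X n A b (x t)" if "Suc T \<le> t" for t
    proof -
      have lt: "cst t < F zs + \<eta>" using T that by simp
      have "tr (z t) \<in> U" using loc[OF M(1) zK] cst_ge[of t] lt by (simp add: tr)
      then have near: "dotp (n i) (A i s) (zs i) \<le> dotp (n i) (A i s) (z t i) + \<epsilon>"
        if "i < N" "s < S" for i s
        using that by (force simp: U_def tr_def)
      \<comment> \<open>The cost is below \<open>F zs + 1\<close> and its unpenalised part is at
        least \<open>F z0\<close>; the penalty has to fit in between.\<close>
      have "M * (\<Sum>i<N. v t i) \<le> F zs + 1 - F z0"
        using lt \<eta>(2) z0[OF zK[of t]] by (simp add: cst_def tr)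
      also have "\<dots> \<le> M * \<epsilon>" using M(3) \<epsilon>(1) by (simp add: field_simps)
      finally have v_small: "(\<Sum>i<N. v t i) \<le> \<epsilon>"
        using M(1) M1 by (simp add: mult_le_cancel_left)
      define \<rho> where "\<rho> i = (if zs i \<in> X i then \<epsilon> else \<Delta>) + v t i" for i
      have x: "x t i \<in> X i \<and> (\<forall>s<S. dotp (n i) (A i s) (x t i) \<le> y t i s + \<rho> i)" if i: "i < N" for i
      proof -
        have lex: "P3_lexmin (X i) (n i) S (c i) (A i) (y t i) (x t i)"
          using run i unfolding alg_run_def by blast
        have "0 \<le> \<rho> i" using primal(2)[OF i, of t] \<epsilon>(1) \<Delta>_nonneg by (simp add: \<rho>_def)
        show ?thesis
        proof (cases "zs i \<in> X i")
          case True
          have "dotp (n i) (A i s) (zs i) \<le> y t i s + \<rho> i" if "s < S" for s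
            using near[OF i that] primal(3)[OF i that, of t] True by (simp add: \<rho>_def)
          from P3_lexmin_rounding[OF lex True \<open>0 \<le> \<rho> i\<close> this] show ?thesis by blast
        next
          case False
          \<comment> \<open>\<open>xL i\<close> exceeds the row minimum by at most
            \<open>\<Delta>\<close>, and that minimum also bounds the usage of \<open>z t i\<close>
            from below, since it extends to the hull.\<close>
          have "dotp (n i) (A i s) (xL i) \<le> y t i s + \<rho> i" if "s < S" for s
            using \<Delta>[OF i that] primal(3)[OF i that, of t] False
              dotp_conv_ge[OF primal(1)[OF i, of t] Lmin[OF i], of s] by (simp add: \<rho>_def)
          from P3_lexmin_rounding[OF lex xL[OF i] \<open>0 \<le> \<rho> i\<close> this] show ?thesis by blast
        qed
      qed
      \<comment> \<open>Every block is charged \<open>\<epsilon>\<close>, and only the blocks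
        outside \<open>X i\<close>, at most \<open>S\<close> in number, are charged
        \<open>\<Delta>\<close>.\<close>
      have "(\<Sum>i<N. \<rho> i) \<le> (\<Sum>i<N. \<epsilon> + (if zs i \<notin> X i then \<Delta> else 0) + v t i)"
        using \<epsilon>(1) by (intro sum_mono) (auto simp: \<rho>_def)
      also have "\<dots> = real N * \<epsilon> + real (card {i. i < N \<and> zs i \<notin> X i}) * \<Delta> + (\<Sum>i<N. v t i)"
        by (simp add: sum.distrib sum.If_cases Int_def)
      also have "\<dots> \<le> real N * \<epsilon> + real (S + 1) * \<Delta> + \<epsilon>"
        using frac v_small \<Delta>_nonneg \<epsilon>(1) by (intro add_mono mult_right_mono) auto
      finally have \<rho>_sum: "(\<Sum>i<N. \<rho> i) \<le> \<sigma>" using \<epsilon>(2) by (simp add: \<sigma>_def sigma)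
      have "(\<Sum>i<N. dotp (n i) (A i s) (x t i)) \<le> b s" if "s < S" for s
      proof -
        have "(\<Sum>i<N. dotp (n i) (A i s) (x t i)) \<le> (\<Sum>i<N. y t i s + \<rho> i)"
          using x that by (intro sum_mono) auto
        then show ?thesis
          using \<rho>_sum allocation_sum[OF run graph init', of s t] that by (simp add: sum.distrib \<beta>_def)
      qed
      then show ?thesis using x unfolding MILP_feasible_def by blast
    qed
    then show ?thesis by (intro exI[of _ "Suc T"]) auto
  qed
  show ?thesis by (intro exI[of _ M0] allI impI) (rule eventually_feasible; assumption)
qed

end
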